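(* Let $m\ge1$ and $0<\alpha<\pi$. For every compact set $Q\subset\Gamma$ with $|Q|=2\alpha$, $$E_m(Q)\ge2\sin^m\frac\alpha2,$$ with equality if and only if $Q$ is an arc of $\Gamma$ (of length $2\alpha$). Consequently $E_m(2\alpha)=2\sin^m\frac\alpha2$.
   Context: $\Gamma$ is the unit circle of $\mathbb{C}$ with arc-length measure $|\cdot|$; $\mathfrak{P}_m(\Gamma)$ is the set of monic algebraic polynomials of degree $m$ all of whose zeros lie on $\Gamma$. For a compact set $Q\subset\Gamma$, $E_m(Q)=\inf\{\max_{z\in Q}|P(z)|:P\in\mathfrak{P}_m(\Gamma)\}$, and $E_m(2\alpha)=\inf\{E_m(Q):Q\subset\Gamma\text{ compact},|Q|=2\alpha\}$. *)

theory Defs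
  imports "HOL-Analysis.Analysis" "HOL-Computational_Algebra.Polynomial"
begin

definition Gamma :: "complex set" where
  "Gamma = sphere 0 1"

definition arc_len :: "complex set \<Rightarrow> real" where
  "arc_len Q = measure lborel {t \<in> {0..<2*pi}. cis t \<in> Q}"

definition monic_circ_polys :: "nat \<Rightarrow> complex poly set" where
  "monic_circ_polys m = {P. degree P = m \<and> lead_coeff P = 1 \<and>
                           (\<forall>z. poly P z = 0 \<longrightarrow> z \<in> Gamma)}"

definition E_set :: "nat \<Rightarrow> complex set \<Rightarrow> real" where
  "E_set m Q = (INF P \<in> monic_circ_polys m. (SUP z \<in> Q. cmod (poly P z)))"

definition E_len :: "nat \<Rightarrow> real \<Rightarrow> real" where
  "E_len m l = (INF Q \<in> {Q. Q \<subseteq> Gamma \<and> compact Q \<and> arc_len Q = l}. E_set m Q)"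

definition is_arc :: "complex set \<Rightarrow> real \<Rightarrow> bool" where
  "is_arc Q l \<longleftrightarrow> (\<exists>a. Q = cis ` {a..a+l})"

end

theory Submission
  imports Defs "HOL-Complex_Analysis.Complex_Analysis"
    "HOL-Computational_Algebra.Fundamental_Theorem_Algebra"
begin

text \<open>
  Write \<open>\<beta> = \<alpha> / 2\<close> and let \<open>P\<close> have all zeros on the circle and satisfy \<open>|P| \<le> M\<close> on
  \<open>Q\<close>. The sublevel set of \<open>P\<close> is, up to isolated points, a finite union of arcs, so \<open>Q\<close> may be
  replaced by a union \<open>E\<close> of \<open>n\<close> disjoint arcs \<open>[a\<^sub>k, b\<^sub>k]\<close> of total length \<open>4\<beta>\<close>. The rational
  function \<open>W(z) = exp(-2i\<beta>) \<Prod> (z - b\<^sub>k) / (z - a\<^sub>k)\<close> is negative real only on \<open>E\<close>, hence a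
  Moebius image \<open>\<phi>\<close> of its square root maps the complement of \<open>E\<close> into the unit disc, vanishes at
  infinity, and has modulus \<open>sin \<beta>\<close> at \<open>0\<close>.

  As \<open>P(z) / z powr (m/2)\<close> is real on the circle up to a constant phase, \<open>P\<close> can be composed with
  the Chebyshev polynomials: there are monic polynomials \<open>D\<^sub>k\<close> of degree \<open>km\<close> with
  \<open>|D\<^sub>k| \<le> 2 (M/2)\<^sup>k\<close> on \<open>E\<close> and \<open>|D\<^sub>k(0)| = 1\<close>. The maximum principle for
  \<open>\<Psi>\<^sub>k = D\<^sub>k \<phi> ^ (km)\<close> on the complement of \<open>E\<close> yields \<open>sin \<beta> ^ (km) \<le> 2 (M/2)\<^sup>k\<close> for all
  \<open>k\<close>, so \<open>M \<ge> 2 sin \<beta> ^ m\<close>.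

  If equality holds, then the functions \<open>\<Psi>\<^sub>k / (M/2)\<^sup>k\<close> are bounded and have modulus \<open>1\<close> at
  \<open>0\<close>, so by Montel's theorem they cannot tend to \<open>0\<close> on an open set. But they do near a finite zero
  of \<open>\<phi>\<close>, or near infinity if \<open>\<phi>\<close> has a multiple zero there, and one of these occurs when
  \<open>n \<ge> 2\<close>; they also do near any further point of the circle where \<open>|P| \<le> M\<close>. So \<open>n = 1\<close> and
  \<open>Q = E\<close>.
\<close>

section \<open>Tools from complex analysis\<close>

text \<open>Raising \<open>g\<close> to a high power makes the penalty \<open>r / (z - e)\<close>, which disposes of the point at
  infinity, harmless.\<close>

lemma maximum_modulus_complement:
  fixes g :: "complex \<Rightarrow> complex" and B :: real
  assumes E: "compact E" "E \<noteq> {}" and hol: "g holomorphic_on -E"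
    and bdd: "\<And>z. norm z \<ge> R \<Longrightarrow> norm (g z) \<le> C"
    and near: "\<And>\<epsilon>. \<epsilon> > 0 \<Longrightarrow> \<exists>U. open U \<and> E \<subseteq> U \<and> (\<forall>z\<in>U-E. norm (g z) \<le> B + \<epsilon>)"
    and B: "B \<ge> 0" and z: "z \<notin> E"
  shows "norm (g z) \<le> B"
proof (rule field_le_epsilon)
  fix \<epsilon> :: real assume \<epsilon>: "\<epsilon> > 0"
  define b where "b = B + \<epsilon>"
  have b: "b > 0" using B \<epsilon> by (simp add: b_def)
  obtain U where U: "open U" "E \<subseteq> U" "\<forall>z\<in>U-E. norm (g z) \<le> b"
    using near[OF \<epsilon>] b_def by auto
  obtain e where e: "e \<in> E" using E by auto
  \<comment> \<open>Removing \<open>z\<close> puts it into the compact set \<open>S\<close> below,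
    where the maximum principle is applied.\<close>
  define V where "V = U - {z}"
  have V: "open V" "E \<subseteq> V" "\<And>z. z \<in> V - E \<Longrightarrow> norm (g z) \<le> b" "z \<notin> V"
    using U z by (auto simp: V_def open_delete)
  obtain r where r: "r > 0" "ball e r \<subseteq> V" using V e by (meson openE subsetD)
  have "norm (g (of_real (max R 0))) \<le> C" by (rule bdd) simp
  then have C0: "C \<ge> 0" using norm_ge_zero order_trans by blast
  have key: "norm (g z) ^ N * r \<le> b ^ N * norm (z - e)" for N
  proof -
    \<comment> \<open>The last entry is chosen so that on the circle of radius \<open>R'\<close> the
      penalty \<open>r / norm (w - e)\<close> brings \<open>C ^ N\<close> down to at most
      \<open>b ^ N\<close>.\<close>
    define R' where "R' = max (max R (norm z)) (norm e + r + C ^ N * r / b ^ N)"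
    define S where "S = cball 0 R' - V"
    define h where "h = (\<lambda>w. g w ^ N * of_real r / (w - e))"
    have S: "S \<subseteq> -E" "compact S" "e \<notin> S" using V r e by (auto simp: S_def compact_diff)
    have holh: "h holomorphic_on S" unfolding h_def
      using S by (intro holomorphic_intros holomorphic_on_subset[OF hol]) auto
    have "norm (h z) \<le> b ^ N"
    proof (rule maximum_modulus_frontier[where S = S and f = h and \<xi> = z])
      show "h holomorphic_on interior S" using holh holomorphic_on_subset interior_subset by blast
      show "continuous_on (closure S) h"
        using holh S by (simp add: compact_imp_closed holomorphic_on_imp_continuous_on)
      show "bounded S" using S compact_imp_bounded by blast
      show "z \<in> S" using V by (auto simp: S_def R'_def)
      fix w assume w: "w \<in> frontier S"
      have wS: "w \<in> S" using w S by (simp add: compact_imp_closed frontier_def)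
      show "norm (h w) \<le> b ^ N"
      proof (cases "norm w = R'")
        case True
        then have gw: "norm (g w) \<le> C" by (intro bdd) (simp add: R'_def)
        have d: "norm (w - e) \<ge> r + C ^ N * r / b ^ N"
          using True norm_triangle_ineq2[of w e] by (simp add: R'_def)
        have pos: "r + C ^ N * r / b ^ N > 0" using r b C0 by (simp add: add_pos_nonneg)
        have "norm (h w) = norm (g w) ^ N * r / norm (w - e)"
          using r by (simp add: h_def norm_mult norm_divide norm_power)
        also have "\<dots> \<le> C ^ N * r / (r + C ^ N * r / b ^ N)"
          using d pos gw r C0 by (intro frac_le mult_right_mono power_mono) auto
        also have "\<dots> \<le> b ^ N"
        proof -
          have "C ^ N * r \<le> b ^ N * (r + C ^ N * r / b ^ N)"
            using b r by (simp add: field_simps)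
          then show ?thesis using pos by (simp add: pos_divide_le_eq)
        qed
        finally show ?thesis .
      next
        case False
        have wV: "w \<in> closure V"
        proof (rule ccontr)
          assume n: "w \<notin> closure V"
          have "norm w < R'" using False wS by (auto simp: S_def)
          then have "w \<in> ball 0 R' - closure V" using n by auto
          moreover have "open (ball 0 R' - closure V)" by auto
          moreover have "ball 0 R' - closure V \<subseteq> S" using closure_subset by (auto simp: S_def)
          ultimately have "w \<in> interior S" by (meson interiorI)
          then show False using w by (simp add: frontier_def)
        qed
        have opE: "open (-E)" using E by (simp add: compact_imp_closed open_Compl)
        have cont: "isCont g w"
          using holomorphic_on_imp_continuous_on[OF hol] opE S wS
          by (auto simp: continuous_on_eq_continuous_at)
        \<comment> \<open>The point \<open>w\<close> lies in the closure of \<open>V\<close> but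
          outside \<open>E\<close>, so an excess over \<open>b\<close> would persist at nearby
          points of \<open>V - E\<close>.\<close>
        have gw: "norm (g w) \<le> b"
        proof (rule ccontr)
          assume "\<not> norm (g w) \<le> b"
          then have "norm (g w) > b" by simp
          moreover have "isCont (\<lambda>x. norm (g x)) w" using cont by (intro continuous_intros)
          ultimately have "eventually (\<lambda>x. norm (g x) > b) (at w)"
            by (simp add: isCont_def order_tendsto_iff)
          then have ev: "eventually (\<lambda>x. norm (g x) > b) (nhds w)"
            using \<open>norm (g w) > b\<close> by (simp add: eventually_nhds_conv_at)
          have "eventually (\<lambda>x. x \<in> -E) (nhds w)"
            using opE S wS by (intro eventually_nhds_in_open) auto
          with ev have "eventually (\<lambda>x. norm (g x) > b \<and> x \<in> -E) (nhds w)"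
            by (rule eventually_conj)
          then obtain T where T: "open T" "w \<in> T" "\<And>x. x \<in> T \<Longrightarrow> norm (g x) > b \<and> x \<in> -E"
            unfolding eventually_nhds by auto
          have "T \<inter> V \<noteq> {}"
            using open_Int_closure_eq_empty[OF T(1), of V] wV T(2) by auto
          then obtain x where "x \<in> T" "x \<in> V" by auto
          then show False using T V(3)[of x] by force
        qed
        have d: "norm (w - e) \<ge> r"
        proof -
          have "w \<notin> ball e r" using r wS by (auto simp: S_def)
          then show ?thesis by (simp add: dist_norm norm_minus_commute)
        qed
        have "norm (h w) = norm (g w) ^ N * (r / norm (w - e))"
          using r by (simp add: h_def norm_mult norm_divide norm_power)
        also have "\<dots> \<le> b ^ N * 1"
          using gw d r b by (intro mult_mono power_mono) (auto simp: divide_simps)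
        finally show ?thesis by simp
      qed
    qed
    moreover have "norm (h z) = norm (g z) ^ N * r / norm (z - e)"
      using r by (simp add: h_def norm_mult norm_divide norm_power)
    moreover have "norm (z - e) > 0" using e z by auto
    ultimately show ?thesis by (simp add: pos_divide_le_eq)
  qed
  show "norm (g z) \<le> B + \<epsilon>"
  proof (rule ccontr)
    assume "\<not> norm (g z) \<le> B + \<epsilon>"
    then have "norm (g z) / b > 1" using b by (simp add: b_def)
    \<comment> \<open>The factor \<open>norm (z - e) / r\<close> does not depend on
      \<open>N\<close>, so taking \<open>N\<close> large removes it.\<close>
    then obtain N where "(norm (g z) / b) ^ N > norm (z - e) / r"
      using real_arch_pow by blast
    moreover have "(norm (g z) / b) ^ N \<le> norm (z - e) / r"
      using key[of N] b r by (simp add: field_simps power_divide)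
    ultimately show False by simp
  qed
qed

text \<open>A Montel limit of a subsequence vanishes on \<open>U\<close>, hence on all of
  \<open>S\<close> by the identity theorem, while its value at \<open>a\<close> has modulus
  1.\<close>

lemma bounded_holomorphic_seq_not_vanishing:
  fixes \<psi> :: "nat \<Rightarrow> complex \<Rightarrow> complex"
  assumes S: "open S" "connected S" and hol: "\<And>k. \<psi> k holomorphic_on S"
    and bd: "\<And>k z. z \<in> S \<Longrightarrow> norm (\<psi> k z) \<le> B"
    and a: "a \<in> S" "\<And>k. norm (\<psi> k a) = 1"
    and U: "open U" "U \<noteq> {}" "U \<subseteq> S" "\<And>z. z \<in> U \<Longrightarrow> (\<lambda>k. \<psi> k z) \<longlonglongrightarrow> 0"
  shows False
proof -
  obtain g r where g: "g holomorphic_on S" "strict_mono (r :: nat \<Rightarrow> nat)"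
    "\<And>x. x \<in> S \<Longrightarrow> (\<lambda>n. \<psi> (r n) x) \<longlonglongrightarrow> g x"
    by (rule Montel[of S "range \<psi>" \<psi>]) (use S hol bd in blast)+
  have "g z = 0" if "z \<in> U" for z
  proof (rule LIMSEQ_unique)
    show "(\<lambda>n. \<psi> (r n) z) \<longlonglongrightarrow> g z" using g(3) that U by blast
    show "(\<lambda>n. \<psi> (r n) z) \<longlonglongrightarrow> 0"
      using LIMSEQ_subseq_LIMSEQ[OF U(4)[OF that] g(2)] by (simp add: o_def)
  qed
  then have "g a = 0"
    using analytic_continuation_open[of U S g "\<lambda>_. 0" a] U S g a by auto
  then have "(\<lambda>n. norm (\<psi> (r n) a)) \<longlonglongrightarrow> 0" using g(3)[OF a(1)] tendsto_norm_zero by metis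
  then show False using a by (simp add: LIMSEQ_const_iff)
qed

section \<open>Chebyshev composition\<close>

text \<open>Dickson polynomials of the first kind: the power sums \<open>l ^ k + l' ^ k\<close> in
  terms of \<open>l + l'\<close> and \<open>l * l'\<close>. The recurrence avoids a square root of
  \<open>c\<close>, so substituting holomorphic functions keeps them holomorphic, also where
  \<open>c\<close> vanishes.\<close>

fun dickson :: "complex \<Rightarrow> complex \<Rightarrow> nat \<Rightarrow> complex" where
  "dickson x c 0 = 2"
| "dickson x c (Suc 0) = x"
| "dickson x c (Suc (Suc k)) = x * dickson x c (Suc k) - c * dickson x c k"

lemma dickson_roots: "dickson (l + l') (l * l') k = l ^ k + l' ^ k"
proof (induction k rule: induct_nat_012)
  case (ge2 k)
  then show ?case by (simp add: algebra_simps)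
qed auto

lemma dickson_0_right: "k > 0 \<Longrightarrow> dickson x 0 k = x ^ k"
  using dickson_roots[of x 0 k] by simp

lemma quadratic_split:
  obtains l l' :: complex where "l + l' = x" "l * l' = c"
proof
  let ?d = "csqrt (x\<^sup>2 - 4 * c)"
  have "(x + ?d) * (x - ?d) = x\<^sup>2 - ?d\<^sup>2" by (simp add: algebra_simps power2_eq_square)
  then have "(x + ?d) * (x - ?d) = 4 * c" by simp
  then show "(x + ?d) / 2 * ((x - ?d) / 2) = c" by simp
  show "(x + ?d) / 2 + (x - ?d) / 2 = x" by (simp add: field_simps)
qed

text \<open>Reduces every estimate of \<open>dickson\<close> to the size of the two roots of one
  quadratic, uniformly in \<open>k\<close>.\<close>

lemma norm_dickson_le_roots:
  assumes "\<And>l. l\<^sup>2 - x * l + c = 0 \<Longrightarrow> norm l \<le> R"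
  shows "norm (dickson x c k) \<le> 2 * R ^ k"
proof -
  obtain l l' where l: "l + l' = x" "l * l' = c" by (rule quadratic_split)
  have "norm l \<le> R" by (rule assms) (simp add: l[symmetric] algebra_simps power2_eq_square)
  moreover have "norm l' \<le> R" by (rule assms) (simp add: l[symmetric] algebra_simps power2_eq_square)
  ultimately have "norm (l ^ k + l' ^ k) \<le> R ^ k + R ^ k"
    by (intro norm_triangle_le add_mono) (auto simp: norm_power power_mono)
  then show ?thesis using dickson_roots[of l l' k] l by simp
qed

text \<open>The bounds \<open>C\<close> and \<open>C\<^sup>2\<close> reflect that the coefficients
  have weights 1 and 2 in the roots. The estimate serves near infinity and keeps sequences of roots
  in a compact set.\<close>

lemma quadratic_root_bound:
  fixes l x c :: complex
  assumes "l\<^sup>2 - x * l + c = 0" and C: "norm x \<le> C" "norm c \<le> C\<^sup>2"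
  shows "norm l \<le> 2 * C"
proof (rule ccontr)
  assume *: "\<not> norm l \<le> 2 * C"
  have C0: "C \<ge> 0" using C(1) norm_ge_zero order_trans by blast
  have "l\<^sup>2 = x * l - c" using assms(1) by algebra
  then have "norm l ^ 2 \<le> norm x * norm l + norm c"
    by (metis norm_mult norm_power norm_triangle_ineq4)
  also have "\<dots> \<le> C * norm l + C\<^sup>2" using C by (intro add_mono mult_right_mono) auto
  also have "\<dots> \<le> C * norm l + C * norm l"
    using * C0 by (auto simp: power2_eq_square intro!: mult_left_mono)
  also have "\<dots> = (2 * C) * norm l" by simp
  also have "\<dots> < norm l * norm l" using * C0 by (intro mult_strict_right_mono) auto
  also have "\<dots> = norm l ^ 2" by (simp add: power2_eq_square)
  finally show False by simp
qed

text \<open>With \<open>v\<^sup>2 = w\<close> the quotient of \<open>p\<close> by \<open>v\<close>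
  is real and at most \<open>M\<close> in modulus, hence equals \<open>M * cos t\<close>; the roots
  are then \<open>M/2 * v * cis t\<close> and \<open>M/2 * v * cis (-t)\<close>.\<close>

lemma quadratic_roots_norm:
  fixes l p w :: complex
  assumes l: "l\<^sup>2 - p * l + (of_real M)\<^sup>2 / 4 * w = 0" and w: "norm w = 1" and p: "p = w * cnj p" "norm p \<le> M"
  shows "norm l = M / 2"
proof -
  define v where "v = csqrt w"
  have v: "v\<^sup>2 = w" "norm v = 1" using w by (auto simp: v_def)
  have vv: "v * cnj v = 1" using v(2) by (simp add: complex_norm_square[symmetric])
  have M0: "M \<ge> 0" using p norm_ge_zero order_trans by blast
  \<comment> \<open>As \<open>v\<close> has modulus 1, \<open>p * cnj v\<close> is the quotient of
    \<open>p\<close> by \<open>v\<close>; it is shown to equal its own conjugate.\<close>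
  have "cnj (p * cnj v) = cnj p * (v * cnj v) * v" by (simp add: vv)
  also have "\<dots> = (w * cnj p) * cnj v" by (simp add: v(1)[symmetric] power2_eq_square)
  also have "\<dots> = p * cnj v" using p by simp
  finally obtain y where y: "p * cnj v = of_real y" by (metis Reals_cnj_iff Reals_cases)
  have "\<bar>y\<bar> \<le> M"
    using p(2) v(2) arg_cong[OF y, of norm] by (simp add: norm_mult)
  then obtain t where t: "y = M * cos t"
  proof (cases "M = 0")
    case False
    then have "cos (arccos (y / M)) = y / M" using \<open>\<bar>y\<bar> \<le> M\<close> M0 by (intro cos_arccos) (auto simp: field_simps)
    then show ?thesis using False that[of "arccos (y / M)"] by simp
  qed (use that in auto)
  have "p = of_real y * v" using y vv by (metis mult.assoc mult.commute mult.right_neutral)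
  then have p2: "p = of_real (M/2) * v * cis t + of_real (M/2) * v * cis (-t)"
    by (simp add: t complex_eq_iff) (simp add: field_simps)
  have c2: "(of_real M)\<^sup>2 / 4 * w = (of_real (M/2) * v * cis t) * (of_real (M/2) * v * cis (-t))"
    by (simp add: v(1)[symmetric] power2_eq_square cis_mult algebra_simps)
  have "(l - of_real (M/2) * v * cis t) * (l - of_real (M/2) * v * cis (-t)) = 0"
    using l unfolding p2 c2 by (simp add: algebra_simps power2_eq_square)
  then have "l = of_real (M/2) * v * cis t \<or> l = of_real (M/2) * v * cis (-t)" by auto
  moreover have "norm (of_real (M/2) * v * cis s) = M / 2" for s
    using M0 v(2) by (simp add: norm_mult del: of_real_divide)
  ultimately show ?thesis by metis
qed

text \<open>Roots depend continuously on the coefficients: violating roots at points tending to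
  \<open>q\<close> stay bounded, and a limit of a subsequence would be a root at \<open>q\<close> of
  modulus at least \<open>R\<close>.\<close>

lemma quadratic_root_bound_nhds:
  fixes x c :: "complex \<Rightarrow> complex"
  assumes cont: "isCont x q" "isCont c q" and R: "\<And>l. l\<^sup>2 - x q * l + c q = 0 \<Longrightarrow> norm l < R"
  shows "eventually (\<lambda>z. \<forall>l. l\<^sup>2 - x z * l + c z = 0 \<longrightarrow> norm l < R) (nhds q)"
proof (rule ccontr)
  assume n: "\<not> ?thesis"
  have "\<exists>z l. dist z q < 1 / real (Suc k) \<and> l\<^sup>2 - x z * l + c z = 0 \<and> norm l \<ge> R" for k
  proof (rule ccontr)
    assume "\<not> ?thesis"
    then have "\<forall>z. dist z q < 1 / real (Suc k) \<longrightarrow> (\<forall>l. l\<^sup>2 - x z * l + c z = 0 \<longrightarrow> norm l < R)"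
      by (meson not_le)
    then have "eventually (\<lambda>z. \<forall>l. l\<^sup>2 - x z * l + c z = 0 \<longrightarrow> norm l < R) (nhds q)"
      unfolding eventually_nhds_metric by (intro exI[of _ "1 / real (Suc k)"]) auto
    then show False using n by simp
  qed
  then obtain z l where zl: "\<And>k. dist (z k) q < 1 / real (Suc k)"
    "\<And>k. (l k)\<^sup>2 - x (z k) * l k + c (z k) = 0" "\<And>k. norm (l k) \<ge> R"
    by metis
  have "z \<longlonglongrightarrow> q"
  proof (rule metric_tendsto_imp_tendsto[OF LIMSEQ_inverse_real_of_nat])
    show "\<forall>\<^sub>F k in sequentially. dist (z k) q \<le> dist (inverse (real (Suc k))) 0"
      using zl(1) by (auto simp: inverse_eq_divide less_imp_le simp del: of_nat_Suc)
  qed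
  then have x: "(\<lambda>k. x (z k)) \<longlonglongrightarrow> x q" and c: "(\<lambda>k. c (z k)) \<longlonglongrightarrow> c q"
    using cont by (auto simp: isCont_tendsto_compose)
  obtain X where X: "\<And>k. norm (x (z k)) \<le> X"
    using convergent_imp_Bseq[OF convergentI[OF x]] unfolding Bseq_def by blast
  obtain Y where Y: "\<And>k. norm (c (z k)) \<le> Y"
    using convergent_imp_Bseq[OF convergentI[OF c]] unfolding Bseq_def by blast
  define C where "C = X + Y + 1"
  have XY: "X \<ge> 0" "Y \<ge> 0" using X[of 0] Y[of 0] norm_ge_zero order_trans by blast+
  have "norm (l k) \<le> 2 * C" for k
  proof (rule quadratic_root_bound[OF zl(2)])
    show "norm (x (z k)) \<le> C" using X[of k] XY by (simp add: C_def)
    have "Y \<le> C * 1" using XY by (simp add: C_def)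
    also have "\<dots> \<le> C * C" using XY by (intro mult_left_mono) (auto simp: C_def)
    finally show "norm (c (z k)) \<le> C\<^sup>2" using Y[of k] by (simp add: power2_eq_square)
  qed
  then have "\<forall>k. l k \<in> cball 0 (2 * C)" by simp
  then obtain L r where r: "strict_mono (r :: nat \<Rightarrow> nat)" "(l \<circ> r) \<longlonglongrightarrow> L"
    using compact_cball[of "0::complex" "2*C"] unfolding compact_def by blast
  have "(\<lambda>k. (l (r k))\<^sup>2 - x (z (r k)) * l (r k) + c (z (r k))) \<longlonglongrightarrow> L\<^sup>2 - x q * L + c q"
    using r LIMSEQ_subseq_LIMSEQ[OF x r(1)] LIMSEQ_subseq_LIMSEQ[OF c r(1)]
    by (intro tendsto_intros) (auto simp: o_def)
  then have "L\<^sup>2 - x q * L + c q = 0" using zl(2) by (simp add: LIMSEQ_const_iff)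
  then have "norm L < R" by (rule R)
  moreover have "norm L \<ge> R"
    using tendsto_norm[OF r(2)] zl(3) by (intro LIMSEQ_le_const[of "\<lambda>k. norm ((l \<circ> r) k)"]) auto
  ultimately show False by simp
qed

lemma dickson_holomorphic:
  assumes "x holomorphic_on S" "c holomorphic_on S"
  shows "(\<lambda>z. dickson (x z) (c z) k) holomorphic_on S"
proof (induction k rule: induct_nat_012)
  case (ge2 k)
  then show ?case using assms by (auto intro!: holomorphic_intros)
qed (use assms in auto)

section \<open>Unions of arcs\<close>

lemma cis_diff: "cis t - cis s = 2 * \<i> * cis ((t + s) / 2) * of_real (sin ((t - s) / 2))"
proof -
  have "cis t = cis ((t + s) / 2) * cis ((t - s) / 2)" "cis s = cis ((t + s) / 2) * cis (-((t - s) / 2))"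
    by (simp_all add: cis_mult field_simps)
  then have "cis t - cis s = cis ((t + s) / 2) * (cis ((t - s) / 2) - cis (-((t - s) / 2)))"
    by (simp only: right_diff_distrib)
  also have "cis ((t - s) / 2) - cis (-((t - s) / 2)) = 2 * \<i> * of_real (sin ((t - s) / 2))"
    by (simp add: complex_eq_iff)
  finally show ?thesis by (simp add: mult_ac)
qed

lemma cis_prod: "(\<Prod>k\<in>S. cis (f k)) = cis (\<Sum>k\<in>S. f k)"
  by (induction S rule: infinite_finite_induct) (auto simp: cis_mult)

lemma cis_eqD:
  assumes "cis s = cis t" "s \<le> t" "t < s + 2 * pi"
  shows "s = t"
proof -
  have "cis (t - s) = 1" using assms(1) by (simp add: cis_divide[symmetric])
  then have "cos (t - s) = 1" by (metis cis.simps(1) one_complex.simps(1))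
  then obtain k :: int where k: "t - s = of_int k * 2 * pi" using cos_one_2pi_int by blast
  have "0 * (2 * pi) \<le> of_int k * (2 * pi)" "of_int k * (2 * pi) < 1 * (2 * pi)"
    using assms(2,3) unfolding mult.assoc[symmetric] k[symmetric] by simp_all
  then have "(0::real) \<le> of_int k" "of_int k < (1::real)"
    using mult_right_le_imp_le[of 0 "2 * pi" "of_int k"] mult_right_less_imp_less[of "of_int k" "2 * pi" 1]
    by auto
  then have "k \<ge> 0" "k < 1" by simp_all
  then have "k = 0" by linarith
  then show ?thesis using k by simp
qed

lemma norm_poly_le:
  fixes q :: "complex poly"
  assumes "degree q \<le> d" "norm z \<ge> 1"
  shows "norm (poly q z) \<le> (\<Sum>i\<le>degree q. norm (coeff q i)) * norm z ^ d"
proof -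
  have "norm (poly q z) \<le> (\<Sum>i\<le>degree q. norm (coeff q i * z ^ i))"
    unfolding poly_altdef by (rule norm_sum)
  also have "\<dots> \<le> (\<Sum>i\<le>degree q. norm (coeff q i) * norm z ^ d)"
    using assms by (intro sum_mono) (auto simp: norm_mult norm_power intro!: mult_left_mono power_increasing)
  finally show ?thesis by (simp add: sum_distrib_right)
qed

lemma linear_prod_poly:
  fixes f :: "nat \<Rightarrow> complex"
  shows "degree (\<Prod>k<n. [:- f k, 1:]) = n" "coeff (\<Prod>k<n. [:- f k, 1:]) n = 1"
    "poly (\<Prod>k<n. [:- f k, 1:]) z = (\<Prod>k<n. z - f k)"
proof -
  show 1: "degree (\<Prod>k<n. [:- f k, 1:]) = n"
    by (subst degree_prod_eq_sum_degree) auto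
  have "lead_coeff (\<Prod>k<n. [:- f k, 1:]) = 1" by (simp only: lead_coeff_prod) simp
  then show "coeff (\<Prod>k<n. [:- f k, 1:]) n = 1" by (simp only: 1)
  show "poly (\<Prod>k<n. [:- f k, 1:]) z = (\<Prod>k<n. z - f k)" by (simp add: poly_prod)
qed

text \<open>Arcs are given by ordered intervals of angles. Taken for all pairs, \<open>wrap\<close>
  places these intervals in one window shorter than \<open>2 * pi\<close>, so the arcs are disjoint
  on the circle as well.\<close>

locale arcs =
  fixes n :: nat and a b :: "nat \<Rightarrow> real" and \<beta> :: real
  assumes ab: "k < n \<Longrightarrow> a k < b k"
    and sep: "j < k \<Longrightarrow> k < n \<Longrightarrow> b j < a k"
    and wrap: "j < n \<Longrightarrow> k < n \<Longrightarrow> b j < a k + 2 * pi"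
    and total: "(\<Sum>k<n. b k - a k) = 4 * \<beta>"
    and \<beta>: "0 < \<beta>" "\<beta> < pi / 2"
begin

definition E :: "complex set" where "E = (\<Union>k<n. cis ` {a k..b k})"

definition A :: "complex poly" where "A = (\<Prod>k<n. [:- cis (a k), 1:])"

definition B :: "complex poly" where "B = (\<Prod>k<n. [:- cis (b k), 1:])"

text \<open>Half the sum of \<open>b k - a k\<close> is \<open>2 * \<beta>\<close>; the constant
  factor cancels the resulting phase and makes \<open>W\<close> real on the circle.\<close>

definition W :: "complex \<Rightarrow> complex" where "W z = cis (- (2 * \<beta>)) * poly B z / poly A z"

text \<open>The Moebius map of the right half-plane onto the unit disc that sends
  \<open>cis (- \<beta>)\<close>, the limit of \<open>csqrt (W z)\<close> at infinity, to 0.\<close>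

definition \<phi> :: "complex \<Rightarrow> complex"
  where "\<phi> z = (csqrt (W z) - cis (- \<beta>)) / (csqrt (W z) + cis \<beta>)"

lemma n_pos: "n > 0"
  using total \<beta> by (cases n) auto

lemma compact_E: "compact E"
  unfolding E_def by (intro compact_UN compact_continuous_image continuous_intros) auto

lemma E_nonempty: "E \<noteq> {}"
  using n_pos ab unfolding E_def by (auto intro: less_imp_le)

lemma E_circle: "z \<in> E \<Longrightarrow> norm z = 1"
  by (auto simp: E_def)

lemma cis_in_E: "k < n \<Longrightarrow> t \<in> {a k..b k} \<Longrightarrow> cis t \<in> E"
  unfolding E_def by blast

lemma poly_A: "poly A z = (\<Prod>k<n. z - cis (a k))" and deg_A: "degree A = n" and lc_A: "coeff A n = 1"
  using linear_prod_poly[where n = n and f = "\<lambda>k. cis (a k)"] by (auto simp: A_def)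

lemma poly_B: "poly B z = (\<Prod>k<n. z - cis (b k))" and deg_B: "degree B = n" and lc_B: "coeff B n = 1"
  using linear_prod_poly[where n = n and f = "\<lambda>k. cis (b k)"] by (auto simp: B_def)

lemma A_nonzero: "z \<notin> E \<Longrightarrow> poly A z \<noteq> 0"
  using cis_in_E ab by (fastforce simp: poly_A)

lemma B_nonzero: "z \<notin> E \<Longrightarrow> poly B z \<noteq> 0"
  using cis_in_E ab by (fastforce simp: poly_B)

definition sA :: "real \<Rightarrow> real" where "sA \<theta> = (\<Prod>k<n. sin ((\<theta> - a k) / 2))"

definition sB :: "real \<Rightarrow> real" where "sB \<theta> = (\<Prod>k<n. sin ((\<theta> - b k) / 2))"

text \<open>The phase shared by \<open>poly A\<close> and \<open>poly B\<close> on the circle. Apart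
  from a constant \<open>cis (2 * \<beta>)\<close> in the second, it leaves the real products
  \<open>sA\<close> and \<open>sB\<close>, so \<open>W\<close> becomes \<open>sB / sA\<close>
  there.\<close>

definition phase :: "real \<Rightarrow> complex"
  where "phase \<theta> = (2 * \<i>) ^ n * cis ((real n * \<theta> + (\<Sum>k<n. a k)) / 2)"

lemma phase_nonzero: "phase \<theta> \<noteq> 0"
  by (simp add: phase_def)

lemma poly_cis_prod:
  "(\<Prod>k<n. cis \<theta> - cis (f k)) = (2 * \<i>) ^ n * cis ((real n * \<theta> + (\<Sum>k<n. f k)) / 2) *
     of_real (\<Prod>k<n. sin ((\<theta> - f k) / 2))"
proof -
  have "(\<Sum>k<n. (\<theta> + f k) / 2) = (real n * \<theta> + (\<Sum>k<n. f k)) / 2"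
    by (simp add: sum_divide_distrib[symmetric] sum.distrib)
  then have "(\<Prod>k<n. cis ((\<theta> + f k) / 2)) = cis ((real n * \<theta> + (\<Sum>k<n. f k)) / 2)"
    unfolding cis_prod by (rule arg_cong)
  then show ?thesis
    unfolding cis_diff prod.distrib by simp
qed

lemma A_cis: "poly A (cis \<theta>) = phase \<theta> * of_real (sA \<theta>)"
  by (simp add: poly_A poly_cis_prod phase_def sA_def)

lemma sum_b: "(\<Sum>k<n. b k) = (\<Sum>k<n. a k) + 4 * \<beta>"
  using total by (simp add: sum_subtractf)

lemma B_cis: "poly B (cis \<theta>) = cis (2 * \<beta>) * phase \<theta> * of_real (sB \<theta>)"
proof -
  have "cis ((real n * \<theta> + (\<Sum>k<n. b k)) / 2) = cis (2 * \<beta>) * cis ((real n * \<theta> + (\<Sum>k<n. a k)) / 2)"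
    unfolding cis_mult sum_b by (rule arg_cong[of _ _ cis]) (simp add: field_simps)
  then show ?thesis
    by (simp add: poly_B poly_cis_prod phase_def sB_def mult_ac)
qed

text \<open>For \<open>j\<close> other than \<open>k\<close> both sines of a pair have arguments in
  the same one of the intervals (0, pi) and (-pi, 0), so they agree in sign; only
  \<open>j = k\<close> contributes a negative pair. This is the sign change that puts a root on each
  arc.\<close>

lemma sA_sB_neg:
  assumes k: "k < n" shows "sB (a k) * sA (b k) < 0"
proof -
  have "sB (a k) * sA (b k) = (\<Prod>j<n. sin ((a k - b j) / 2) * sin ((b k - a j) / 2))"
    by (simp add: sA_def sB_def prod.distrib)
  also have "\<dots> = (sin ((a k - b k) / 2) * sin ((b k - a k) / 2)) *
      (\<Prod>j\<in>{..<n}-{k}. sin ((a k - b j) / 2) * sin ((b k - a j) / 2))"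
    using k by (subst prod.remove[of _ k]) auto
  also have "\<dots> < 0"
  proof (rule mult_neg_pos)
    have "sin ((b k - a k) / 2) > 0" using ab[OF k] wrap[OF k k] by (intro sin_gt_zero) auto
    moreover have "sin ((a k - b k) / 2) = - sin ((b k - a k) / 2)"
      by (metis minus_diff_eq minus_divide_left sin_minus)
    ultimately show "sin ((a k - b k) / 2) * sin ((b k - a k) / 2) < 0" by simp
    show "(\<Prod>j\<in>{..<n}-{k}. sin ((a k - b j) / 2) * sin ((b k - a j) / 2)) > 0"
    proof (rule prod_pos)
      fix j assume j: "j \<in> {..<n}-{k}"
      show "sin ((a k - b j) / 2) * sin ((b k - a j) / 2) > 0"
      proof (cases "j < k")
        case True
        have "sin ((a k - b j) / 2) > 0" "sin ((b k - a j) / 2) > 0"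
          using sep[OF True k] wrap[of k j] ab[of k] ab[of j] k j by (auto intro!: sin_gt_zero)
        then show ?thesis by simp
      next
        case False
        then have jk: "k < j" "j < n" using j by auto
        have "sin ((b j - a k) / 2) > 0" "sin ((a j - b k) / 2) > 0"
          using sep[OF jk] wrap[of j k] ab[of k] ab[of j] k jk by (auto intro!: sin_gt_zero)
        moreover have "sin ((a k - b j) / 2) = - sin ((b j - a k) / 2)"
          "sin ((b k - a j) / 2) = - sin ((a j - b k) / 2)"
          by (metis minus_diff_eq minus_divide_left sin_minus)+
        ultimately show ?thesis by simp
      qed
    qed
  qed
  finally show ?thesis .
qed

lemma sB_b: "k < n \<Longrightarrow> sB (b k) = 0" and sA_a: "k < n \<Longrightarrow> sA (a k) = 0"
  unfolding sA_def sB_def by (rule prod_zero, simp, rule bexI[of _ k], simp, simp)+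

lemma arc_point_inj:
  assumes "\<And>k. k < n \<Longrightarrow> t k \<in> {a k..b k}"
  shows "inj_on (\<lambda>k. cis (t k)) {..<n}"
proof -
  have lt: "t j < t k \<and> t k < t j + 2 * pi" if "j < k" "k < n" for j k
    using sep[OF that] wrap[of k j] assms[of j] assms[of k] that by auto
  have ne: "cis (t j) \<noteq> cis (t k)" if "j < k" "k < n" for j k
    using cis_eqD[of "t j" "t k"] lt[OF that] by auto
  show ?thesis
    by (rule inj_onI) (metis ne lessThan_iff linorder_neqE_nat)
qed

text \<open>On the circle \<open>W\<close> is real and runs from \<open>-\<infinity>\<close> to \<open>0\<close> along each arc, so all \<open>n\<close>
  solutions of \<open>W z = -r\<close> lie on the arcs.\<close>

lemma W_not_nonpos_real:
  assumes z: "z \<notin> E" shows "W z \<notin> \<real>\<^sub>\<le>\<^sub>0"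
proof
  assume "W z \<in> \<real>\<^sub>\<le>\<^sub>0"
  then obtain r where r: "W z = - of_real r" "r \<ge> 0"
    by (metis minus_minus neg_0_le_iff_le nonpos_Reals_cases of_real_minus)
  have "W z \<noteq> 0" using A_nonzero[OF z] B_nonzero[OF z] by (simp add: W_def)
  then have r0: "r > 0" using r by (cases "r = 0") auto
  \<comment> \<open>Clearing denominators in \<open>W z = - r\<close> gives a polynomial of degree
    at most \<open>n\<close>, which is shown to have a root on every arc in addition to
    \<open>z\<close>.\<close>
  define D where "D = smult (cis (- (2 * \<beta>))) B + smult (of_real r) A"
  have Dz: "poly D z = 0"
    using r A_nonzero[OF z] by (simp add: D_def W_def divide_eq_eq)
  have D_cis: "poly D (cis \<theta>) = phase \<theta> * of_real (sB \<theta> + r * sA \<theta>)" for \<theta>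
    using cis_mult[of "- (2 * \<beta>)" "2 * \<beta>"]
    by (simp add: D_def A_cis B_cis algebra_simps)
  have "\<exists>\<theta>\<in>{a k..b k}. poly D (cis \<theta>) = 0" if k: "k < n" for k
  proof -
    let ?G = "\<lambda>\<theta>. sB \<theta> + r * sA \<theta>"
    have cont: "continuous_on {a k..b k} ?G"
      unfolding sA_def sB_def by (intro continuous_intros) auto
    have "?G (a k) * ?G (b k) = r * (sB (a k) * sA (b k))"
      using k by (simp add: sB_b sA_a)
    then have neg: "?G (a k) * ?G (b k) < 0"
      using sA_sB_neg[OF k] r0 by (simp add: mult_pos_neg)
    have "\<exists>\<theta>. a k \<le> \<theta> \<and> \<theta> \<le> b k \<and> ?G \<theta> = 0"
    proof (cases "?G (a k) < 0")
      case True
      then show ?thesis using neg ab[OF k] cont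
        by (intro IVT') (auto simp: mult_less_0_iff)
    next
      case False
      then show ?thesis using neg ab[OF k] cont
        by (intro IVT2') (auto simp: mult_less_0_iff)
    qed
    then obtain \<theta> where "\<theta> \<in> {a k..b k}" "?G \<theta> = 0" by auto
    then show ?thesis using D_cis[of \<theta>] by auto
  qed
  then obtain \<theta> where \<theta>: "\<And>k. k < n \<Longrightarrow> \<theta> k \<in> {a k..b k}" "\<And>k. k < n \<Longrightarrow> poly D (cis (\<theta> k)) = 0"
    by metis
  \<comment> \<open>The leading coefficient is not real because \<open>0 < 2 * \<beta> < pi\<close>,
    so \<open>D\<close> cannot vanish identically.\<close>
  have "coeff D n = cis (- (2 * \<beta>)) + of_real r" by (simp add: D_def lc_A lc_B)
  moreover have "Im (cis (- (2 * \<beta>)) + of_real r) \<noteq> 0"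
    using \<beta> sin_gt_zero[of "2 * \<beta>"] by simp
  ultimately have D0: "D \<noteq> 0" by (metis coeff_0 zero_complex.simps(2))
  have degD: "degree D \<le> n" unfolding D_def
    by (intro degree_add_le order.trans[OF degree_smult_le]) (auto simp: deg_A deg_B)
  let ?R = "insert z ((\<lambda>k. cis (\<theta> k)) ` {..<n})"
  have "?R \<subseteq> {x. poly D x = 0}" using Dz \<theta> by auto
  then have "card ?R \<le> card {x. poly D x = 0}" using poly_roots_finite[OF D0] by (intro card_mono)
  also have "\<dots> \<le> n" using card_poly_roots_bound[OF D0] degD by simp
  finally have "card ?R \<le> n" .
  moreover have "z \<notin> (\<lambda>k. cis (\<theta> k)) ` {..<n}" using \<theta> z cis_in_E by auto
  ultimately show False using arc_point_inj[OF \<theta>(1)] by (simp add: card_image)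
qed

section \<open>The map \<phi> into the unit disc: values, growth and zeros\<close>

lemma Re_csqrt_W: "z \<notin> E \<Longrightarrow> Re (csqrt (W z)) > 0"
proof -
  assume z: "z \<notin> E"
  have "Re (csqrt (W z)) \<noteq> 0"
  proof
    assume "Re (csqrt (W z)) = 0"
    then have "(csqrt (W z))\<^sup>2 = of_real (- (Im (csqrt (W z)))\<^sup>2)"
      by (simp add: complex_eq_iff power2_eq_square)
    then have "W z = of_real (- (Im (csqrt (W z)))\<^sup>2)" by simp
    then have "W z \<in> \<real>\<^sub>\<le>\<^sub>0" by (metis neg_le_0_iff_le nonpos_Reals_of_real_iff zero_le_power2)
    then show False using W_not_nonpos_real[OF z] by simp
  qed
  then show ?thesis using Re_csqrt[of "W z"] by linarith
qed

lemma W_holomorphic: "W holomorphic_on -E"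
  unfolding W_def using A_nonzero by (intro holomorphic_intros) auto

lemma cos_\<beta>: "cos \<beta> > 0"
  using \<beta> by (intro cos_gt_zero) auto

lemma norm_csqrt_add_cis:
  assumes "z \<notin> E" shows "norm (csqrt (W z) + cis \<beta>) \<ge> cos \<beta>" "norm (csqrt (W z) + cis (- \<beta>)) \<ge> cos \<beta>"
proof -
  have *: "cos \<beta> \<le> norm (w + cis s)" if "Re w > 0" "cos s = cos \<beta>" for w s
    using that complex_Re_le_cmod[of "w + cis s"] by simp
  show "norm (csqrt (W z) + cis \<beta>) \<ge> cos \<beta>" "norm (csqrt (W z) + cis (- \<beta>)) \<ge> cos \<beta>"
    using Re_csqrt_W[OF assms] by (auto intro!: * simp del: csqrt.simps)
qed

lemma \<phi>_holomorphic: "\<phi> holomorphic_on -E"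
proof -
  have "csqrt (W z) + cis \<beta> \<noteq> 0" if "z \<notin> E" for z
    using norm_csqrt_add_cis(1)[OF that] cos_\<beta> by fastforce
  moreover have "(\<lambda>z. csqrt (W z)) holomorphic_on -E"
    using holomorphic_on_compose_gen[OF W_holomorphic holomorphic_on_csqrt] W_not_nonpos_real
    by (auto simp: o_def)
  ultimately show ?thesis unfolding \<phi>_def
    by (intro holomorphic_on_divide holomorphic_on_diff holomorphic_on_add holomorphic_on_const) auto
qed

lemma norm_\<phi>_less_1:
  assumes "z \<notin> E" shows "norm (\<phi> z) < 1"
proof -
  let ?w = "csqrt (W z)"
  \<comment> \<open>The points \<open>cis (- \<beta>)\<close> and \<open>- cis \<beta>\<close> are
    mirror images in the imaginary axis, so the right half-plane is nearer to the first.\<close>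
  have "norm (?w + cis \<beta>) ^ 2 - norm (?w - cis (- \<beta>)) ^ 2 = 4 * cos \<beta> * Re ?w"
    unfolding cmod_power2 by (simp add: power2_eq_square algebra_simps)
  moreover have "4 * cos \<beta> * Re ?w > 0" using Re_csqrt_W[OF assms] cos_\<beta> by simp
  ultimately have "norm (?w - cis (- \<beta>)) ^ 2 < norm (?w + cis \<beta>) ^ 2" by simp
  then have "norm (?w - cis (- \<beta>)) < norm (?w + cis \<beta>)" by (simp add: power_less_imp_less_base)
  then show ?thesis by (simp add: \<phi>_def norm_divide divide_less_eq)
qed

text \<open>At the origin \<open>W\<close> equals \<open>cis (2 * \<beta>)\<close>, whose principal
  root is \<open>cis \<beta>\<close> since \<open>cos \<beta> > 0\<close>.\<close>

lemma norm_\<phi>_0: "norm (\<phi> 0) = sin \<beta>"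
proof -
  have "poly A 0 = (-1) ^ n * cis (\<Sum>k<n. a k)" "poly B 0 = (-1) ^ n * cis (\<Sum>k<n. b k)"
    by (simp_all add: poly_A poly_B cis_prod[symmetric] prod_uminus)
  then have "W 0 = cis (- (2 * \<beta>)) * cis (\<Sum>k<n. b k) / cis (\<Sum>k<n. a k)"
    by (simp add: W_def)
  also have "\<dots> = (cis \<beta>)\<^sup>2"
    by (simp add: cis_mult cis_divide sum_b power2_eq_square)
  finally have "csqrt (W 0) = cis \<beta>" using cos_\<beta> by (simp add: csqrt_square)
  then have "\<phi> 0 = (cis \<beta> - cis (- \<beta>)) / (2 * cis \<beta>)" by (simp add: \<phi>_def)
  also have "cis \<beta> - cis (- \<beta>) = 2 * \<i> * of_real (sin \<beta>)" by (simp add: complex_eq_iff)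
  finally show ?thesis using \<beta> sin_gt_zero[of \<beta>] by (simp add: norm_divide norm_mult)
qed

text \<open>Multiplying numerator and denominator by \<open>csqrt (W z) + cis (- \<beta>)\<close>
  removes the root from the numerator. It shows that \<phi> vanishes at the zeros of
  \<open>B - A\<close> outside \<open>E\<close> and controls its decay at infinity.\<close>

lemma norm_\<phi>_le:
  assumes "z \<notin> E" shows "norm (\<phi> z) \<le> norm (poly (B - A) z) / norm (poly A z) / (cos \<beta>)\<^sup>2"
proof -
  let ?w = "csqrt (W z)"
  have nz: "?w + cis \<beta> \<noteq> 0" "?w + cis (- \<beta>) \<noteq> 0"
    using norm_csqrt_add_cis[OF assms] cos_\<beta> by (metis norm_zero not_le)+
  have "?w\<^sup>2 - (cis (- \<beta>))\<^sup>2 = cis (- (2 * \<beta>)) * (poly (B - A) z / poly A z)"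
    using A_nonzero[OF assms]
    by (simp add: W_def[of z] cis_mult power2_eq_square[of "cis _"] diff_divide_distrib right_diff_distrib del: csqrt.simps)
  then have "(?w - cis (- \<beta>)) * (?w + cis (- \<beta>)) = cis (- (2 * \<beta>)) * (poly (B - A) z / poly A z)"
    by (simp add: algebra_simps power2_eq_square)
  moreover have "\<phi> z = (?w - cis (- \<beta>)) * (?w + cis (- \<beta>)) / ((?w + cis \<beta>) * (?w + cis (- \<beta>)))"
    using nz by (simp add: \<phi>_def del: csqrt.simps)
  ultimately have "\<phi> z = cis (- (2 * \<beta>)) * (poly (B - A) z / poly A z) / ((?w + cis \<beta>) * (?w + cis (- \<beta>)))"
    by simp
  then have "norm (\<phi> z) = norm (poly (B - A) z) / norm (poly A z) / (norm (?w + cis \<beta>) * norm (?w + cis (- \<beta>)))"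
    by (simp add: norm_divide norm_mult)
  also have "\<dots> \<le> norm (poly (B - A) z) / norm (poly A z) / (cos \<beta> * cos \<beta>)"
    using norm_csqrt_add_cis[OF assms] cos_\<beta> by (intro divide_left_mono mult_mono mult_pos_pos) auto
  finally show ?thesis by (simp add: power2_eq_square)
qed

lemma A_lower:
  assumes "norm z \<ge> 2" shows "norm (poly A z) \<ge> (norm z / 2) ^ n"
proof -
  have "(\<Prod>k<n. norm z / 2) \<le> (\<Prod>k<n. norm (z - cis (a k)))"
  proof (rule prod_mono)
    fix k show "0 \<le> norm z / 2 \<and> norm z / 2 \<le> norm (z - cis (a k))"
      using norm_triangle_ineq2[of z "cis (a k)"] assms by simp
  qed
  then show ?thesis by (simp add: poly_A prod_norm)
qed

text \<open>The drop in degree from \<open>A\<close> to \<open>B - A\<close> bounds below the order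
  of the zero of \<phi> at infinity. It is at least 1 as both polynomials are monic, and at least
  \<open>n\<close> if \<open>B - A\<close> is constant.\<close>

lemma \<phi>_growth:
  assumes "degree (B - A) \<le> d" "d \<le> n"
  obtains K where "K \<ge> 0" "\<And>z. norm z \<ge> 2 \<Longrightarrow> norm (\<phi> z) \<le> K / norm z ^ (n - d)"
proof
  let ?c = "\<Sum>i\<le>degree (B - A). norm (coeff (B - A) i)"
  let ?K = "?c * 2 ^ n / (cos \<beta>)\<^sup>2"
  show "?K \<ge> 0" by (simp add: sum_nonneg)
  fix z :: complex assume z: "norm z \<ge> 2"
  have zE: "z \<notin> E" using E_circle z by force
  have "norm (\<phi> z) \<le> norm (poly (B - A) z) / norm (poly A z) / (cos \<beta>)\<^sup>2"
    by (rule norm_\<phi>_le[OF zE])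
  also have "\<dots> \<le> (?c * norm z ^ d) / (norm z / 2) ^ n / (cos \<beta>)\<^sup>2"
  proof (intro divide_right_mono frac_le)
    show "norm (poly (B - A) z) \<le> ?c * norm z ^ d" using norm_poly_le[OF assms(1)] z by simp
    show "(norm z / 2) ^ n > 0" using z by (intro zero_less_power) linarith
  qed (use A_lower[OF z] in \<open>auto simp: sum_nonneg\<close>)
  also have "\<dots> = ?K / norm z ^ (n - d)"
  proof -
    have "norm z ^ n = norm z ^ d * norm z ^ (n - d)" using assms(2) by (simp add: power_add[symmetric])
    moreover have "z \<noteq> 0" using z by auto
    ultimately show ?thesis by (simp add: power_divide)
  qed
  finally show "norm (\<phi> z) \<le> ?K / norm z ^ (n - d)" .
qed

lemma deg_diff: "degree (B - A) \<le> n - 1"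
proof (rule degree_le, intro allI impI)
  fix i assume "i > n - 1"
  then consider "i = n" | "i > n" by linarith
  then show "coeff (B - A) i = 0"
    by cases (auto simp: lc_A lc_B coeff_eq_0 deg_A deg_B)
qed

text \<open>On the circle a zero of \<open>B - A\<close> solves
  \<open>cis (2 * \<beta>) * sB = sA\<close> with real \<open>sA\<close> and \<open>sB\<close>. As
  \<open>sin (2 * \<beta>)\<close> is nonzero, both vanish, which would make a left endpoint
  coincide with a right one.\<close>

lemma root_diff_not_in_E:
  assumes "poly (B - A) z = 0" shows "z \<notin> E"
proof
  assume "z \<in> E"
  then obtain \<theta> where \<theta>: "z = cis \<theta>" by (auto simp: E_def)
  have "phase \<theta> * (cis (2 * \<beta>) * of_real (sB \<theta>) - of_real (sA \<theta>)) = 0"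
    using assms by (simp add: \<theta> A_cis B_cis algebra_simps)
  then have eq: "cis (2 * \<beta>) * of_real (sB \<theta>) = of_real (sA \<theta>)" using phase_nonzero by simp
  have "sin (2 * \<beta>) * sB \<theta> = 0" using arg_cong[OF eq, of Im] by simp
  moreover have "sin (2 * \<beta>) > 0" using \<beta> by (intro sin_gt_zero) auto
  ultimately have 0: "sB \<theta> = 0" by simp
  then have "sA \<theta> = 0" using eq by simp
  then have "poly A z = 0" "poly B z = 0" using 0 by (auto simp: \<theta> A_cis B_cis)
  then obtain j k where jk: "j < n" "k < n" "z = cis (a j)" "z = cis (b k)"
    by (auto simp: poly_A poly_B)
  show False
  proof (cases "j \<le> k")
    case True
    have "a j < b k" using True ab[of k] ab[of j] sep[of j k] jk by (cases "j = k") auto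
    then show False using cis_eqD[of "a j" "b k"] wrap[of k j] jk by auto
  next
    case False
    then have "b k < a j" using sep jk by auto
    moreover have "a j < b k + 2 * pi" using ab[of j] ab[of k] wrap[of j k] jk by linarith
    ultimately show False using cis_eqD[of "b k" "a j"] jk by auto
  qed
qed

text \<open>Needed for the identity theorem. The open disc and the exterior remain connected after
  adding circle points from their closures, and they meet at a point of the circle outside
  \<open>E\<close>.\<close>

lemma connected_compl_E: "connected (- E)"
proof -
  have half: "connected ((ball 0 1 :: complex set) \<union> (sphere 0 1 - E))"
    by (rule connected_intermediate_closure[of "ball 0 1"]) auto
  have "connected (- cball (0::complex) 1)"
    by (rule connected_complement_bounded_convex) auto
  then have half': "connected ((- cball 0 1) \<union> (sphere 0 1 - E))"
  proof (rule connected_intermediate_closure)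
    have "closure (- cball (0::complex) 1) = - ball 0 1"
      by (simp add: closure_complement)
    then show "- cball 0 1 \<union> (sphere 0 1 - E) \<subseteq> closure (- cball (0::complex) 1)" by auto
  qed simp
  have "\<exists>q. norm q = 1 \<and> q \<notin> E"
  proof (rule ccontr)
    assume none: "\<not> (\<exists>q. norm q = 1 \<and> q \<notin> E)"
    have all: "cis t \<in> E" for t using none norm_cis[of t] by blast
    \<comment> \<open>The midpoint of the gap between the last arc and the first one shifted by a
      full turn.\<close>
    define t where "t = (b (n - 1) + (a 0 + 2 * pi)) / 2"
    have n: "0 < n" "n - 1 < n" using n_pos by auto
    have t: "b (n - 1) < t" "t < a 0 + 2 * pi" using wrap[OF n(2) n(1)] by (auto simp: t_def)
    obtain k s where ks: "k < n" "s \<in> {a k..b k}" "cis t = cis s" using all[of t] by (auto simp: E_def)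
    have "b k \<le> b (n - 1)"
    proof (cases "k = n - 1")
      case False
      then have "k < n - 1" using ks by linarith
      then show ?thesis using sep[OF _ n(2)] ab[OF n(2)] by force
    qed simp
    moreover have "a 0 \<le> a k" using ks sep[of 0 k] ab[of 0] n by (cases "k = 0") auto
    ultimately have "s < t" "t < s + 2 * pi" using ks t by auto
    then show False using cis_eqD[of s t] ks by auto
  qed
  then obtain q where q: "norm q = 1" "q \<notin> E" by auto
  have "- E = (ball 0 1 \<union> (sphere 0 1 - E)) \<union> ((- cball 0 1) \<union> (sphere 0 1 - E))"
    using E_circle by (auto simp: less_le)
  moreover have "connected \<dots>" using q by (intro connected_Un[OF half half']) auto
  ultimately show ?thesis by simp
qed

end

section \<open>Polynomials bounded on a union of arcs\<close>

text \<open>Listing the zeros with multiplicity lets limits of polynomials be taken zero by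
  zero.\<close>

definition circ_poly :: "(nat \<Rightarrow> complex) \<Rightarrow> nat \<Rightarrow> complex \<Rightarrow> complex"
  where "circ_poly w m z = (\<Prod>i<m. z - w i)"

lemma circ_poly_holomorphic [holomorphic_intros]: "circ_poly w m holomorphic_on S"
  unfolding circ_poly_def by (intro holomorphic_intros)

lemma isCont_circ_poly: "isCont (circ_poly w m) z"
  unfolding circ_poly_def by (intro continuous_intros)

text \<open>On the circle \<open>circ_poly w m z / z powr (m/2)\<close> is real up to a constant phase.\<close>

lemma circ_poly_reflect:
  assumes w: "\<And>i. i < m \<Longrightarrow> norm (w i) = 1" and z: "norm z = 1"
  shows "circ_poly w m z = circ_poly w m 0 * z ^ m * cnj (circ_poly w m z)"
proof -
  have factor: "z - w i = (0 - w i) * z * cnj (z - w i)" if "i < m" for i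
  proof -
    have "w i * cnj (w i) = 1" "z * cnj z = 1"
      using w[OF that] z by (simp_all add: complex_norm_square[symmetric])
    then show ?thesis by simp algebra
  qed
  have "circ_poly w m z = (\<Prod>i<m. (0 - w i) * z * cnj (z - w i))"
    unfolding circ_poly_def by (intro prod.cong refl factor) simp
  also have "\<dots> = circ_poly w m 0 * z ^ m * cnj (circ_poly w m z)"
    unfolding circ_poly_def prod.distrib by simp
  finally show ?thesis .
qed

lemma norm_circ_poly_0: "(\<And>i. i < m \<Longrightarrow> norm (w i) = 1) \<Longrightarrow> norm (circ_poly w m 0) = 1"
  by (simp add: circ_poly_def prod_norm[symmetric])

lemma norm_circ_poly_le:
  assumes w: "\<And>i. i < m \<Longrightarrow> norm (w i) = 1" and z: "norm z \<ge> 1"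
  shows "norm (circ_poly w m z) \<le> 2 ^ m * norm z ^ m"
proof -
  have "norm (circ_poly w m z) \<le> (\<Prod>i<m. 2 * norm z)"
    unfolding circ_poly_def prod_norm[symmetric]
  proof (intro prod_mono conjI)
    fix i assume "i \<in> {..<m}"
    then show "norm (z - w i) \<le> 2 * norm z" using norm_triangle_ineq4[of z "w i"] w[of i] z by simp
  qed simp
  then show ?thesis by (simp add: power_mult_distrib)
qed

locale arcs_poly = arcs +
  fixes m :: nat and w :: "nat \<Rightarrow> complex" and M :: real
  assumes m: "m \<ge> 1" and w: "\<And>i. i < m \<Longrightarrow> norm (w i) = 1" and M: "M > 0"
    and bound: "\<And>z. z \<in> E \<Longrightarrow> norm (circ_poly w m z) \<le> M"
begin

abbreviation p :: "complex \<Rightarrow> complex" where "p \<equiv> circ_poly w m"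

text \<open>The product of the two roots: \<open>M\<^sup>2 / 4\<close> times the factor relating
  \<open>p z\<close> to its conjugate on the circle. Where \<open>norm (p z) \<le> M\<close> on the
  circle, both roots then have modulus \<open>M / 2\<close>.\<close>

definition c :: "complex \<Rightarrow> complex" where "c z = (of_real M)\<^sup>2 / 4 * (p 0 * z ^ m)"

text \<open>The first factor is \<open>2 (M/2)\<^sup>k T\<^sub>k(P/M)\<close>, homogenised so as to be a polynomial in \<open>z\<close>.\<close>

definition \<Psi> :: "nat \<Rightarrow> complex \<Rightarrow> complex" where "\<Psi> k z = dickson (p z) (c z) k * \<phi> z ^ (k * m)"

lemma c_holomorphic: "c holomorphic_on S"
  unfolding c_def by (intro holomorphic_intros) auto

lemma \<Psi>_holomorphic: "\<Psi> k holomorphic_on -E"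
  unfolding \<Psi>_def
  by (intro holomorphic_intros dickson_holomorphic c_holomorphic \<phi>_holomorphic)

lemma root_norm:
  assumes "norm z = 1" "norm (p z) \<le> M" "l\<^sup>2 - p z * l + c z = 0"
  shows "norm l = M / 2"
proof (rule quadratic_roots_norm)
  show "l\<^sup>2 - p z * l + (of_real M)\<^sup>2 / 4 * (p 0 * z ^ m) = 0" using assms by (simp add: c_def)
  show "norm (p 0 * z ^ m) = 1" using assms w by (simp add: norm_mult norm_power norm_circ_poly_0)
  show "p z = p 0 * z ^ m * cnj (p z)" using assms w by (intro circ_poly_reflect) auto
qed (use assms in auto)

text \<open>The growth \<open>norm z ^ m\<close> of the roots is exactly what
  \<open>\<phi> z ^ m\<close> compensates at infinity, where \<phi> has at least a simple
  zero.\<close>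

lemma roots_growth:
  obtains C where "C > 0" "\<And>z l. norm z \<ge> 1 \<Longrightarrow> l\<^sup>2 - p z * l + c z = 0 \<Longrightarrow> norm l \<le> C * norm z ^ m"
proof
  let ?C = "2 ^ m + M / 2 :: real"
  show "2 * ?C > 0" using M by (simp add: add_pos_pos)
  fix z l :: complex assume z: "norm z \<ge> 1" and l: "l\<^sup>2 - p z * l + c z = 0"
  have "norm l \<le> 2 * (?C * norm z ^ m)"
  proof (rule quadratic_root_bound[OF l])
    have "norm (p z) \<le> 2 ^ m * norm z ^ m" using norm_circ_poly_le w z by auto
    also have "\<dots> \<le> ?C * norm z ^ m" using M by (intro mult_right_mono) auto
    finally show "norm (p z) \<le> ?C * norm z ^ m" .
    have "norm (c z) = (M / 2)\<^sup>2 * norm z ^ m"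
      using w by (simp add: c_def norm_mult norm_power norm_circ_poly_0 norm_divide power_divide)
    also have "\<dots> \<le> ?C\<^sup>2 * (norm z ^ m)\<^sup>2"
    proof (intro mult_mono power_mono)
      have "1 \<le> norm z ^ m" using z by simp
      then show "norm z ^ m \<le> (norm z ^ m)\<^sup>2" by (simp add: power2_eq_square)
    qed (use M in auto)
    finally show "norm (c z) \<le> (?C * norm z ^ m)\<^sup>2" by (simp add: power_mult_distrib)
  qed
  then show "norm l \<le> 2 * ?C * norm z ^ m" by (simp only: mult.assoc)
qed

lemma norm_\<Psi>_le_roots:
  assumes "\<And>l. l\<^sup>2 - p z * l + c z = 0 \<Longrightarrow> norm l \<le> R"
  shows "norm (\<Psi> k z) \<le> 2 * (R * norm (\<phi> z) ^ m) ^ k"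
proof -
  have "norm (\<Psi> k z) \<le> 2 * R ^ k * norm (\<phi> z) ^ (k * m)"
    unfolding \<Psi>_def norm_mult norm_power
    by (intro mult_right_mono norm_dickson_le_roots assms) auto
  then show ?thesis by (simp add: power_mult_distrib power_mult[symmetric] mult.commute)
qed

text \<open>Near \<open>E\<close> the Dickson factor is almost bounded by
  \<open>2 * (M / 2) ^ k\<close> and \<phi> has modulus below 1; near infinity the zero of \<phi>
  keeps the product bounded. The maximum principle does the rest.\<close>

lemma norm_\<Psi>_le:
  assumes "z \<notin> E" shows "norm (\<Psi> k z) \<le> 2 * (M / 2) ^ k"
proof -
  obtain K where K: "K \<ge> 0" "\<And>z. norm z \<ge> 2 \<Longrightarrow> norm (\<phi> z) \<le> K / norm z ^ (n - (n - 1))"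
    using \<phi>_growth[OF deg_diff] by auto
  have K': "norm (\<phi> z) \<le> K / norm z" if "norm z \<ge> 2" for z using K(2)[OF that] n_pos by simp
  obtain C where C: "C > 0" "\<And>z l. norm z \<ge> 1 \<Longrightarrow> l\<^sup>2 - p z * l + c z = 0 \<Longrightarrow> norm l \<le> C * norm z ^ m"
    by (rule roots_growth) blast
  show ?thesis
  proof (rule maximum_modulus_complement[OF compact_E E_nonempty \<Psi>_holomorphic])
    show "norm (\<Psi> k z) \<le> 2 * (C * K ^ m) ^ k" if z: "norm z \<ge> 2" for z
    proof -
      have "norm (\<Psi> k z) \<le> 2 * (C * norm z ^ m * norm (\<phi> z) ^ m) ^ k"
        using z C by (intro norm_\<Psi>_le_roots) auto
      also have "\<dots> \<le> 2 * (C * norm z ^ m * (K / norm z) ^ m) ^ k"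
        using K'[OF z] C by (intro mult_left_mono power_mono) auto
      also have "\<dots> = 2 * (C * K ^ m) ^ k"
        using z by (auto simp: power_divide)
      finally show ?thesis .
    qed
  next
    fix \<epsilon> :: real assume \<epsilon>: "\<epsilon> > 0"
    \<comment> \<open>The Dickson factor is continuous on the whole plane, so this neighbourhood of
      \<open>E\<close> is open without reference to boundary values of \<phi>.\<close>
    let ?U = "{z. norm (dickson (p z) (c z) k) < 2 * (M / 2) ^ k + \<epsilon>}"
    have "continuous_on UNIV (\<lambda>z. dickson (p z) (c z) k)"
      by (intro holomorphic_on_imp_continuous_on dickson_holomorphic holomorphic_intros c_holomorphic)
    then have "open ?U" by (intro open_Collect_less continuous_intros)
    moreover have "E \<subseteq> ?U"
    proof
      fix z assume z: "z \<in> E"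
      have "norm (dickson (p z) (c z) k) \<le> 2 * (M / 2) ^ k"
        using root_norm[OF E_circle[OF z] bound[OF z]] by (intro norm_dickson_le_roots) auto
      then show "z \<in> ?U" using \<epsilon> by simp
    qed
    moreover have "norm (\<Psi> k z) \<le> 2 * (M / 2) ^ k + \<epsilon>" if z: "z \<in> ?U - E" for z
    proof -
      have "norm (\<Psi> k z) \<le> norm (dickson (p z) (c z) k) * 1"
        unfolding \<Psi>_def norm_mult norm_power using norm_\<phi>_less_1[of z] z
        by (intro mult_left_mono power_le_one) auto
      then show ?thesis using z by simp
    qed
    ultimately show "\<exists>U. open U \<and> E \<subseteq> U \<and> (\<forall>z\<in>U-E. norm (\<Psi> k z) \<le> 2 * (M / 2) ^ k + \<epsilon>)"
      by blast
  qed (use assms M in auto)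
qed

lemma norm_\<Psi>_0: "k > 0 \<Longrightarrow> norm (\<Psi> k 0) = (sin \<beta> ^ m) ^ k"
proof -
  assume k: "k > 0"
  \<comment> \<open>At the origin the Dickson polynomial collapses to the pure power
    \<open>p 0 ^ k\<close>, which removes the factor 2 from the value.\<close>
  have "c 0 = 0" using m by (simp add: c_def)
  then show "norm (\<Psi> k 0) = (sin \<beta> ^ m) ^ k"
    using k w by (simp add: \<Psi>_def dickson_0_right norm_mult norm_power norm_circ_poly_0 norm_\<phi>_0
        power_mult[symmetric] mult.commute)
qed

section \<open>The lower bound and the case of equality\<close>

lemma zero_not_in_E: "0 \<notin> E"
  using E_circle by force

lemma lower_bound: "2 * sin \<beta> ^ m \<le> M"
proof (rule ccontr)
  assume "\<not> 2 * sin \<beta> ^ m \<le> M"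
  then have "sin \<beta> ^ m / (M / 2) > 1" using M by (simp add: field_simps)
  \<comment> \<open>The factor 2 is independent of \<open>k\<close>, so a ratio above 1 is refuted
    by a large power.\<close>
  then obtain k where k: "(sin \<beta> ^ m / (M / 2)) ^ k > 2" using real_arch_pow by blast
  then have "k > 0" by (cases k) auto
  then have "(sin \<beta> ^ m) ^ k \<le> 2 * (M / 2) ^ k"
    using norm_\<Psi>_le[OF zero_not_in_E, of k] by (simp add: norm_\<Psi>_0)
  then show False using k M by (simp add: power_divide field_simps)
qed

text \<open>Under equality the normalised functions have modulus 1 at the origin, while the
  assumption on \<open>R\<close> makes them decay geometrically at each point of
  \<open>U\<close>.\<close>

lemma extremal_open_False:
  assumes Meq: "M = 2 * sin \<beta> ^ m" and U: "open U" "U \<noteq> {}" "U \<subseteq> -E"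
    and R: "\<And>z. z \<in> U \<Longrightarrow> \<exists>R. (\<forall>l. l\<^sup>2 - p z * l + c z = 0 \<longrightarrow> norm l \<le> R) \<and> R * norm (\<phi> z) ^ m < M / 2"
  shows False
proof (rule bounded_holomorphic_seq_not_vanishing)
  \<comment> \<open>The index starts at 1 because \<open>dickson\<close> is the constant 2 at index
    0, which would spoil the value at the origin.\<close>
  let ?\<psi> = "\<lambda>k z. \<Psi> (Suc k) z / of_real (M / 2) ^ Suc k"
  show "open (-E)" using compact_E by (simp add: compact_imp_closed open_Compl)
  show "?\<psi> k holomorphic_on -E" for k
    using M by (intro holomorphic_intros \<Psi>_holomorphic) auto
  show "norm (?\<psi> k z) \<le> 2" if "z \<in> -E" for k z
    using norm_\<Psi>_le[of z "Suc k"] that M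
    by (simp add: norm_divide norm_power norm_mult field_simps)
  show "norm (?\<psi> k 0) = 1" for k
  proof -
    have "M / 2 = sin \<beta> ^ m" using Meq by simp
    then have "norm (of_real (M / 2) ^ Suc k :: complex) = (sin \<beta> ^ m) ^ Suc k"
      using M unfolding norm_power norm_of_real by simp
    moreover have "(sin \<beta> ^ m) ^ Suc k \<noteq> 0" using M Meq m by (auto simp: power_0_left)
    ultimately show ?thesis
      unfolding norm_divide norm_\<Psi>_0[OF zero_less_Suc] by simp
  qed
  show "(\<lambda>k. ?\<psi> k z) \<longlonglongrightarrow> 0" if z: "z \<in> U" for z
  proof -
    obtain R where R: "\<And>l. l\<^sup>2 - p z * l + c z = 0 \<Longrightarrow> norm l \<le> R" "R * norm (\<phi> z) ^ m < M / 2"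
      using R[OF z] by blast
    obtain l l' where l: "l + l' = p z" "l * l' = c z" by (rule quadratic_split)
    have "l\<^sup>2 - p z * l + c z = 0" by (simp add: l[symmetric] algebra_simps power2_eq_square)
    then have R0: "R \<ge> 0" using R(1) norm_ge_zero order_trans by blast
    let ?x = "R * norm (\<phi> z) ^ m / (M / 2)"
    have x: "0 \<le> ?x" "?x < 1" using R R0 M by auto
    have "(\<lambda>k. 2 * ?x ^ Suc k) \<longlonglongrightarrow> 2 * 0"
      using x by (intro tendsto_mult_left LIMSEQ_Suc LIMSEQ_power_zero) auto
    then have lim: "(\<lambda>k. 2 * ?x ^ Suc k) \<longlonglongrightarrow> 0" by simp
    have "norm (?\<psi> k z) \<le> 2 * ?x ^ Suc k" for k
    proof -
      have "norm (?\<psi> k z) = norm (\<Psi> (Suc k) z) / (M / 2) ^ Suc k"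
        using M by (simp add: norm_divide norm_power norm_mult)
      also have "\<dots> \<le> 2 * (R * norm (\<phi> z) ^ m) ^ Suc k / (M / 2) ^ Suc k"
        using M by (intro divide_right_mono norm_\<Psi>_le_roots R) auto
      finally show ?thesis by (simp only: power_divide times_divide_eq_right)
    qed
    then show ?thesis by (intro Lim_null_comparison[OF always_eventually lim] allI)
  qed
qed (use U connected_compl_E zero_not_in_E in auto)

text \<open>Strict inequalities at one point spread to a neighbourhood, since the roots and \<phi>
  vary continuously.\<close>

lemma extremal_point_False:
  assumes Meq: "M = 2 * sin \<beta> ^ m" and q: "q \<notin> E"
    and R: "\<And>l. l\<^sup>2 - p q * l + c q = 0 \<Longrightarrow> norm l < R" "R * norm (\<phi> q) ^ m < M / 2"
  shows False
proof -
  have op: "open (-E)" using compact_E by (simp add: compact_imp_closed open_Compl)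
  have "isCont c q" unfolding c_def by (intro continuous_intros)
  then have 1: "\<forall>\<^sub>F z in nhds q. \<forall>l. l\<^sup>2 - p z * l + c z = 0 \<longrightarrow> norm l < R"
    by (intro quadratic_root_bound_nhds isCont_circ_poly R(1))
  have "continuous_on (-E) (\<lambda>z. R * norm (\<phi> z) ^ m)"
    by (intro continuous_intros holomorphic_on_imp_continuous_on \<phi>_holomorphic)
  then have "isCont (\<lambda>z. R * norm (\<phi> z) ^ m) q"
    using op q by (simp add: continuous_on_eq_continuous_at)
  then have "\<forall>\<^sub>F z in at q. R * norm (\<phi> z) ^ m < M / 2"
    unfolding isCont_def by (rule order_tendstoD(2)[OF _ R(2)])
  then have 2: "\<forall>\<^sub>F z in nhds q. R * norm (\<phi> z) ^ m < M / 2"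
    unfolding eventually_nhds_conv_at using R(2) by blast
  have 3: "\<forall>\<^sub>F z in nhds q. z \<in> -E" using op q by (intro eventually_nhds_in_open) auto
  obtain U where U: "open U" "q \<in> U"
    "\<And>z. z \<in> U \<Longrightarrow> (\<forall>l. l\<^sup>2 - p z * l + c z = 0 \<longrightarrow> norm l < R) \<and> R * norm (\<phi> z) ^ m < M / 2 \<and> z \<in> -E"
    using eventually_conj[OF 1 eventually_conj[OF 2 3]] unfolding eventually_nhds by blast
  show False
    by (rule extremal_open_False[OF Meq U(1)]) (use U(2,3) less_imp_le in blast)+
qed

lemma extremal_not_on_circle:
  assumes Meq: "M = 2 * sin \<beta> ^ m" and q: "q \<notin> E" "norm q = 1"
  shows "norm (p q) > M"
proof (rule ccontr)
  assume "\<not> M < norm (p q)"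
  then have pq: "norm (p q) \<le> M" by simp
  let ?x = "norm (\<phi> q) ^ m"
  \<comment> \<open>Because \<open>?x < 1\<close>, this value satisfies both
    \<open>M / 2 < ?R\<close> and \<open>?R * ?x < M / 2\<close>.\<close>
  let ?R = "M / (1 + ?x)"
  have x: "?x \<ge> 0" "?x < 1" using norm_\<phi>_less_1[OF q(1)] m by (auto simp: power_less_one_iff)
  show False
  proof (rule extremal_point_False[OF Meq q(1)])
    show "norm l < ?R" if "l\<^sup>2 - p q * l + c q = 0" for l
    proof -
      have "M / 2 * (1 + ?x) < M" using x M by (simp add: field_simps)
      moreover have "1 + ?x > 0" using x by linarith
      ultimately have "M / 2 < ?R" by (simp only: pos_less_divide_eq)
      then show ?thesis by (simp only: root_norm[OF q(2) pq that])
    qed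
    have "M * ?x < M / 2 * (1 + ?x)" using x M by (simp add: field_simps)
    moreover have "1 + ?x > 0" using x by linarith
    ultimately show "?R * ?x < M / 2" by (simp only: times_divide_eq_left pos_divide_less_eq)
  qed
qed

lemma extremal_single_arc:
  assumes Meq: "M = 2 * sin \<beta> ^ m" shows "n = 1"
proof (rule ccontr)
  assume "n \<noteq> 1"
  then have n2: "n \<ge> 2" using n_pos by linarith
  obtain C where C: "C > 0" "\<And>z l. norm z \<ge> 1 \<Longrightarrow> l\<^sup>2 - p z * l + c z = 0 \<Longrightarrow> norm l \<le> C * norm z ^ m"
    by (rule roots_growth) blast
  show False
  \<comment> \<open>Either \<open>B - A\<close> has a root, which is a finite zero of \<phi>, or
    \<phi> has a zero of order at least \<open>n \<ge> 2\<close> at infinity.\<close>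
  proof (cases "degree (B - A) = 0")
    case False
    then obtain z where z: "poly (B - A) z = 0"
      using alg_closed_imp_poly_has_root[of "B - A"] by auto
    have zE: "z \<notin> E" by (rule root_diff_not_in_E[OF z])
    have "\<phi> z = 0" using norm_\<phi>_le[OF zE] z by simp
    moreover obtain l l' where l: "l + l' = p z" "l * l' = c z" by (rule quadratic_split)
    have "norm x < norm l + norm l' + 1" if "x\<^sup>2 - p z * x + c z = 0" for x
    proof -
      have "(x - l) * (x - l') = 0" using that by (simp add: l[symmetric] algebra_simps power2_eq_square)
      then have "norm x = norm l \<or> norm x = norm l'" by auto
      then show ?thesis using norm_ge_zero[of l] norm_ge_zero[of l'] by linarith
    qed
    \<comment> \<open>As \<open>\<phi> z = 0\<close>, any \<open>R\<close> above both roots will do;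
      \<open>m \<ge> 1\<close> makes \<open>0 ^ m\<close> vanish.\<close>
    ultimately show False using M m by (intro extremal_point_False[OF Meq zE, of "norm l + norm l' + 1"]) (auto simp: power_0_left)
  next
    case True
    then obtain K where K: "K \<ge> 0" "\<And>z. norm z \<ge> 2 \<Longrightarrow> norm (\<phi> z) \<le> K / norm z ^ n"
      using \<phi>_growth[of 0] by auto
    \<comment> \<open>Beyond this radius \<open>C * K ^ m / norm z\<close> is below
      \<open>M / 2\<close>.\<close>
    define \<rho> where "\<rho> = max 2 (2 * C * K ^ m / M)"
    let ?U = "- cball (0::complex) \<rho>"
    show False
    proof (rule extremal_open_False[OF Meq])
      have "\<rho> \<ge> 2" by (simp add: \<rho>_def)
      then have "of_real (\<rho> + 1) \<in> ?U" by (simp del: of_real_add)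
      then show "?U \<noteq> {}" by blast
      show "?U \<subseteq> -E" using E_circle by (auto simp: \<rho>_def)
      fix z assume "z \<in> ?U"
      then have z: "norm z > 2" "norm z > 2 * C * K ^ m / M" by (auto simp: \<rho>_def)
      show "\<exists>R. (\<forall>l. l\<^sup>2 - p z * l + c z = 0 \<longrightarrow> norm l \<le> R) \<and> R * norm (\<phi> z) ^ m < M / 2"
      proof (intro exI conjI allI impI)
        show "norm l \<le> C * norm z ^ m" if "l\<^sup>2 - p z * l + c z = 0" for l using C that z by simp
        \<comment> \<open>A zero of order 2 already beats the growth of the roots, leaving
          \<open>C * K ^ m / norm z ^ m\<close>.\<close>
        have "norm (\<phi> z) \<le> K / norm z ^ n" using K z by simp
        also have "\<dots> \<le> K / norm z ^ 2"
          using z K n2 by (intro divide_left_mono power_increasing mult_pos_pos zero_less_power) auto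
        finally have "C * norm z ^ m * norm (\<phi> z) ^ m \<le> C * norm z ^ m * (K / norm z ^ 2) ^ m"
          using C by (intro mult_left_mono power_mono) auto
        also have "\<dots> = C * K ^ m / norm z ^ m"
          using z by (simp add: power_divide power2_eq_square power_mult_distrib)
        also have "\<dots> \<le> C * K ^ m / norm z ^ 1"
          using z C K m by (intro divide_left_mono power_increasing mult_pos_pos zero_less_power) auto
        also have "\<dots> < M / 2"
        proof -
          have "C * K ^ m < M / 2 * norm z" using z M by (simp add: field_simps)
          moreover have "norm z > 0" using z by linarith
          ultimately show ?thesis by (simp only: power_one_right pos_divide_less_eq)
        qed
        finally show "C * norm z ^ m * norm (\<phi> z) ^ m < M / 2" .
      qed
    qed auto
  qed
qed

end

section \<open>Sublevel sets and arc length\<close>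

text \<open>The sublevel set is exhausted only in measure, so isolated points may be dropped and all
  intervals have positive length.\<close>

definition interval_decomp ::
    "(real \<Rightarrow> real) \<Rightarrow> real \<Rightarrow> real \<Rightarrow> nat \<Rightarrow> (nat \<Rightarrow> real) \<Rightarrow> (nat \<Rightarrow> real) \<Rightarrow> bool"
  where "interval_decomp g u v n a b \<longleftrightarrow>
    (\<forall>k<n. a k < b k \<and> u \<le> a k \<and> b k \<le> v \<and> (\<forall>t\<in>{a k..b k}. g t \<le> 0)) \<and>
    (\<forall>j k. j < k \<and> k < n \<longrightarrow> b j < a k) \<and>
    measure lborel {t\<in>{u..v}. g t \<le> 0} \<le> (\<Sum>k<n. b k - a k)"

lemma compact_sublevel:
  fixes g :: "real \<Rightarrow> real"
  assumes "continuous_on UNIV g" shows "compact {t\<in>{u..v}. g t \<le> 0}"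
proof -
  have "closed {t. g t \<le> 0}" using assms by (intro closed_Collect_le continuous_intros)
  then have "compact ({u..v} \<inter> {t. g t \<le> 0})" by (intro compact_Int_closed) auto
  moreover have "{u..v} \<inter> {t. g t \<le> 0} = {t\<in>{u..v}. g t \<le> 0}" by auto
  ultimately show ?thesis by simp
qed

lemma measure_sublevel_split:
  fixes g :: "real \<Rightarrow> real"
  assumes g: "continuous_on UNIV g" and C: "compact C"
    and sub: "{t\<in>{u..v}. g t \<le> 0} \<subseteq> {t\<in>{u..z}. g t \<le> 0} \<union> C"
  shows "measure lborel {t\<in>{u..v}. g t \<le> 0} \<le> measure lborel {t\<in>{u..z}. g t \<le> 0} + measure lborel C"
proof -
  have c: "compact {t\<in>{u..v}. g t \<le> 0}" "compact {t\<in>{u..z}. g t \<le> 0}"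
    by (rule compact_sublevel[OF g])+
  have "measure lborel {t\<in>{u..v}. g t \<le> 0} \<le> measure lborel ({t\<in>{u..z}. g t \<le> 0} \<union> C)"
    using c C by (intro measure_mono_fmeasurable sub fmeasurable_compact compact_Un) (auto intro: borel_compact)
  also have "\<dots> \<le> measure lborel {t\<in>{u..z}. g t \<le> 0} + measure lborel C"
    using c C by (intro measure_Un_le) (auto intro: borel_compact)
  finally show ?thesis .
qed

text \<open>Without zeros in (z, v) the sign there is constant. A positive sign adds at most the
  point \<open>v\<close>; a negative one adds the interval from \<open>z\<close> to
  \<open>v\<close>.\<close>

lemma interval_decomp_extend:
  assumes g: "continuous_on UNIV g" and d: "interval_decomp g u z n a b" and zv: "u \<le> z" "z < v"
    and nz: "\<And>t. z < t \<Longrightarrow> t < v \<Longrightarrow> g t \<noteq> 0"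
  shows "\<exists>n a b. interval_decomp g u v n a b"
proof -
  have d1: "\<And>k. k < n \<Longrightarrow> a k < b k \<and> u \<le> a k \<and> b k \<le> z \<and> (\<forall>t\<in>{a k..b k}. g t \<le> 0)"
    and d2: "\<And>j k. j < k \<Longrightarrow> k < n \<Longrightarrow> b j < a k"
    and d3: "measure lborel {t\<in>{u..z}. g t \<le> 0} \<le> (\<Sum>k<n. b k - a k)"
    using d by (auto simp: interval_decomp_def)
  consider (pos) "\<And>t. z < t \<Longrightarrow> t < v \<Longrightarrow> g t > 0" | (neg) "\<And>t. z < t \<Longrightarrow> t < v \<Longrightarrow> g t < 0"
  proof (cases "\<exists>s. z < s \<and> s < v \<and> g s < 0")
    case False
    then show ?thesis using nz pos by (meson not_less_iff_gr_or_eq)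
  next
    case True
    then obtain s where s: "z < s" "s < v" "g s < 0" by auto
    have cont: "continuous_on S g" for S using g continuous_on_subset by blast
    have "g t < 0" if t: "z < t" "t < v" for t
    proof (rule ccontr)
      assume "\<not> g t < 0"
      then have gt: "g t \<ge> 0" by simp
      have "\<exists>x. min s t \<le> x \<and> x \<le> max s t \<and> g x = 0"
      proof (cases "s \<le> t")
        case True
        then show ?thesis using IVT'[of g s 0 t] s gt cont by auto
      next
        case False
        then show ?thesis using IVT2'[of g s 0 t] s gt cont by auto
      qed
      then show False using nz s t by (metis le_less_trans less_le_trans max_less_iff_conj min_less_iff_conj)
    qed
    then show ?thesis using neg by blast
  qed
  then show ?thesis
  proof cases
    case pos
    have "{t\<in>{u..v}. g t \<le> 0} \<subseteq> {t\<in>{u..z}. g t \<le> 0} \<union> {v}"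
    proof
      fix t assume t: "t \<in> {t\<in>{u..v}. g t \<le> 0}"
      then have "\<not> (z < t \<and> t < v)" using pos[of t] by auto
      then show "t \<in> {t\<in>{u..z}. g t \<le> 0} \<union> {v}" using t by auto
    qed
    from measure_sublevel_split[OF g _ this] d3
    have "measure lborel {t\<in>{u..v}. g t \<le> 0} \<le> (\<Sum>k<n. b k - a k)" by simp
    then have "interval_decomp g u v n a b"
      unfolding interval_decomp_def using d1 d2 zv by force
    then show ?thesis by blast
  next
    case neg
    have gle: "g t \<le> 0" if "t \<in> {z..v}" for t
    proof -
      have "closed {t. g t \<le> 0}" using g by (intro closed_Collect_le continuous_intros)
      moreover have "{z<..<v} \<subseteq> {t. g t \<le> 0}" using neg by (auto intro: less_imp_le)
      ultimately have "closure {z<..<v} \<subseteq> {t. g t \<le> 0}" by (rule closure_minimal[rotated])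
      then show ?thesis using that zv by auto
    qed
    have "{t\<in>{u..v}. g t \<le> 0} \<subseteq> {t\<in>{u..z}. g t \<le> 0} \<union> {z..v}" by auto
    from measure_sublevel_split[OF g _ this] d3 zv
    have meas: "measure lborel {t\<in>{u..v}. g t \<le> 0} \<le> (\<Sum>k<n. b k - a k) + (v - z)" by simp
    show ?thesis
    \<comment> \<open>If the last interval ends at \<open>z\<close>, it is prolonged to
      \<open>v\<close>; appending a new one would violate strict separation.\<close>
    proof (cases "n > 0 \<and> b (n - 1) = z")
      case True
      then obtain n' where n: "n = Suc n'" "b n' = z" by (cases n) auto
      let ?b = "b(n' := v)"
      have "(\<Sum>k<n. ?b k - a k) = (\<Sum>k<n. b k - a k) + (v - z)" using n by simp
      then have "measure lborel {t\<in>{u..v}. g t \<le> 0} \<le> (\<Sum>k<n. ?b k - a k)" using meas by simp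
      moreover have "a k < ?b k \<and> u \<le> a k \<and> ?b k \<le> v \<and> (\<forall>t\<in>{a k..?b k}. g t \<le> 0)" if k: "k < n" for k
      proof (cases "k = n'")
        case True
        have "g t \<le> 0" if "t \<in> {a k..v}" for t
          using that gle[of t] d1[OF k] True n by (cases "t \<le> z") auto
        then show ?thesis using True d1[OF k] n zv by auto
      qed (use d1[OF k] zv in auto)
      moreover have "?b j < a k" if "j < k" "k < n" for j k using d2[OF that] that n by auto
      ultimately have "interval_decomp g u v n a ?b" unfolding interval_decomp_def by blast
      then show ?thesis by blast
    next
      case False
      have bz: "b k < z" if k: "k < n" for k
      proof (cases "k = n - 1")
        case True
        then show ?thesis using False d1[OF k] k by auto
      next
        case neq: False
        then have "k < n - 1" "n - 1 < n" using k by auto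
        then show ?thesis using d2[of k "n - 1"] d1[of "n - 1"] by fastforce
      qed
      let ?a = "a(n := z)" and ?b = "b(n := v)"
      have "(\<Sum>k<Suc n. ?b k - ?a k) = (\<Sum>k<n. b k - a k) + (v - z)" by simp
      then have "measure lborel {t\<in>{u..v}. g t \<le> 0} \<le> (\<Sum>k<Suc n. ?b k - ?a k)" using meas by simp
      moreover have "?a k < ?b k \<and> u \<le> ?a k \<and> ?b k \<le> v \<and> (\<forall>t\<in>{?a k..?b k}. g t \<le> 0)" if k: "k < Suc n" for k
        using d1[of k] k zv gle by (cases "k = n") auto
      moreover have "?b j < ?a k" if "j < k" "k < Suc n" for j k
        using d2[of j k] bz[of j] that by (cases "k = n") auto
      ultimately have "interval_decomp g u v (Suc n) ?a ?b" unfolding interval_decomp_def by blast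
      then show ?thesis by blast
    qed
  qed
qed

text \<open>Induction removes the largest zero, which becomes the new right endpoint; hence
  \<open>v\<close> is left arbitrary.\<close>

lemma interval_decomp_exists:
  assumes g: "continuous_on UNIV g" and Z: "finite Z"
  shows "u \<le> v \<Longrightarrow> (\<And>t. u < t \<Longrightarrow> t < v \<Longrightarrow> g t = 0 \<Longrightarrow> t \<in> Z) \<Longrightarrow> \<exists>n a b. interval_decomp g u v n a b"
  using Z
proof (induction Z arbitrary: v rule: finite_linorder_max_induct)
  case empty
  have "{t\<in>{u..u}. g t \<le> 0} \<subseteq> {u}" by auto
  then have "measure lborel {t\<in>{u..u}. g t \<le> 0} \<le> measure lborel {u}"
    by (intro measure_mono_fmeasurable)
      (use borel_compact[OF compact_sublevel[OF g, of u u]] in \<open>auto intro: fmeasurable_compact simp del: atLeastAtMost_singleton\<close>)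
  then have d: "interval_decomp g u u 0 (\<lambda>_. 0) (\<lambda>_. 0)" by (simp add: interval_decomp_def)
  show ?case
  proof (cases "u = v")
    case False
    then show ?thesis using interval_decomp_extend[OF g d, of v] empty by force
  qed (use d in blast)
next
  case (insert z Z)
  show ?case
  proof (cases "u < z \<and> z < v")
    case True
    then obtain n a b where "interval_decomp g u z n a b"
      using insert.IH[of z] insert.prems(2) by fastforce
    then show ?thesis
    proof (rule interval_decomp_extend[OF g])
      fix t assume t: "z < t" "t < v"
      then have "t \<notin> insert z Z" using insert.hyps by auto
      then show "g t \<noteq> 0" using insert.prems(2)[of t] t True by auto
    qed (use True in auto)
  next
    case False
    show ?thesis
    proof (rule insert.IH[OF insert.prems(1)])
      fix t assume "u < t" "t < v" "g t = 0"
      then show "t \<in> Z" using insert.prems(2)[of t] False by auto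
    qed
  qed
qed

section \<open>Arc length and passage from compact sets to arcs\<close>

lemma cis_vimage_closed: "closed Q \<Longrightarrow> closed {t. cis t \<in> Q}"
  using closed_vimage[of Q "\<lambda>t. cis t"] by (simp add: vimage_def continuous_on_cis continuous_on_id)

text \<open>Allows the circle to be cut open at any angle, later at a point where the polynomial
  exceeds \<open>M\<close> or at the start of an arc.\<close>

lemma arc_len_shift:
  assumes "closed Q"
  shows "arc_len Q = measure lborel {t\<in>{c..<c + 2 * pi}. cis t \<in> Q}"
proof -
  define T where "T = {t. cis t \<in> Q}"
  have T: "T \<in> sets borel" using cis_vimage_closed[OF assms] by (auto simp: T_def)
  have per: "t + of_int k * (2 * pi) \<in> T \<longleftrightarrow> t \<in> T" for t and k :: int
  proof -
    have "cis (of_int k * (2 * pi)) = 1"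
      using cis_multiple_2pi[of "of_int k"] by (simp add: mult_ac)
    then have "cis (t + of_int k * (2 * pi)) = cis t"
      by (simp add: cis_mult[symmetric])
    then show ?thesis by (simp add: T_def)
  qed
  define \<mu> where "\<mu> x y = measure lborel (T \<inter> {x..<y})" for x y
  have shift: "\<mu> (x + of_int k * (2 * pi)) (y + of_int k * (2 * pi)) = \<mu> x y" for x y and k :: int
  proof -
    let ?s = "of_int k * (2 * pi)"
    have "(+) ?s ` (T \<inter> {x..<y}) = T \<inter> {x + ?s..<y + ?s}"
    proof (intro equalityI subsetI)
      fix t assume "t \<in> T \<inter> {x + ?s..<y + ?s}"
      then have "t - ?s \<in> T \<inter> {x..<y}" using per[of "t - ?s" k] by auto
      then have "?s + (t - ?s) \<in> (+) ?s ` (T \<inter> {x..<y})" by (rule imageI)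
      then show "t \<in> (+) ?s ` (T \<inter> {x..<y})" by simp
    qed (auto simp: per add.commute[of ?s])
    then have "measure lebesgue (T \<inter> {x + ?s..<y + ?s}) = measure lebesgue (T \<inter> {x..<y})"
      using measure_translation[of ?s "T \<inter> {x..<y}"] by simp
    then show ?thesis using T unfolding \<mu>_def by (simp add: measure_completion)
  qed
  have split: "\<mu> x z = \<mu> x y + \<mu> y z" if "x \<le> y" "y \<le> z" for x y z
  proof -
    have fm: "T \<inter> {x..<y} \<in> fmeasurable lborel" for x y
      by (rule fmeasurableI2[of "{x..y}"]) (use T in \<open>auto intro: fmeasurable_compact\<close>)
    have "T \<inter> {x..<z} = (T \<inter> {x..<y}) \<union> (T \<inter> {y..<z})" using that by auto
    moreover have "measure lborel ((T \<inter> {x..<y}) \<union> (T \<inter> {y..<z})) = \<mu> x y + \<mu> y z"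
      unfolding \<mu>_def using T fmeasurableD2[OF fm] by (intro measure_Union) auto
    ultimately show ?thesis by (simp add: \<mu>_def)
  qed
  \<comment> \<open>Reducing \<open>c\<close> modulo \<open>2 * pi\<close> gives \<open>d\<close> in
    the standard window; the part of the shifted window beyond \<open>2 * pi\<close> is moved back
    by one period.\<close>
  define k where "k = \<lfloor>c / (2 * pi)\<rfloor>"
  define d where "d = c - of_int k * (2 * pi)"
  have "of_int k \<le> c / (2 * pi)" "c / (2 * pi) < of_int k + 1" unfolding k_def by linarith+
  then have d: "0 \<le> d" "d \<le> 2 * pi" unfolding d_def by (auto simp: field_simps)
  have "\<mu> c (c + 2 * pi) = \<mu> d (d + 2 * pi)"
    using shift[of d k "d + 2 * pi"] by (simp add: d_def)
  also have "\<dots> = \<mu> d (2 * pi) + \<mu> (2 * pi) (d + 2 * pi)" using d by (intro split) auto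
  also have "\<mu> (2 * pi) (d + 2 * pi) = \<mu> 0 d" using shift[of 0 1 d] by simp
  also have "\<mu> d (2 * pi) + \<mu> 0 d = \<mu> 0 (2 * pi)" using d split[of 0 d "2 * pi"] by simp
  finally have "\<mu> 0 (2 * pi) = \<mu> c (c + 2 * pi)" ..
  moreover have "{t\<in>{x..<y}. cis t \<in> Q} = T \<inter> {x..<y}" for x y by (auto simp: T_def)
  ultimately show ?thesis unfolding arc_len_def \<mu>_def by simp
qed

text \<open>By \<open>circ_poly_reflect\<close>, points of the circle with \<open>norm p = M\<close>
  are roots of \<open>F\<close>, the square of \<open>p\<close> minus a monomial. At the zero
  \<open>w 0\<close> of \<open>p\<close> the modulus of \<open>F\<close> is
  \<open>M\<^sup>2\<close>, so \<open>F\<close> is not zero.\<close>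

lemma finite_level_set:
  assumes w: "\<And>i. i < m \<Longrightarrow> norm (w i) = 1" and m: "m \<ge> 1" and M: "M > 0"
  shows "finite {t\<in>{c<..<c + 2 * pi}. norm (circ_poly w m (cis t)) = M}"
proof -
  define P where "P = (\<Prod>i<m. [:- w i, 1:])"
  define F where "F = P ^ 2 - smult (circ_poly w m 0 * (of_real M)\<^sup>2) (monom 1 m)"
  have P: "poly P z = circ_poly w m z" for z
    by (simp add: P_def circ_poly_def poly_prod)
  have "circ_poly w m (w 0) = 0" using m by (auto simp: circ_poly_def intro!: bexI[of _ 0])
  then have "norm (poly F (w 0)) = norm (- (circ_poly w m 0 * (of_real M)\<^sup>2 * w 0 ^ m))"
    by (simp add: F_def P poly_monom)
  also have "\<dots> = M\<^sup>2"
    using w[of 0] w m by (simp add: norm_mult norm_power norm_circ_poly_0)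
  finally have "F \<noteq> 0" using M by auto
  then have fin: "finite {z. poly F z = 0}" by (rule poly_roots_finite)
  have root: "poly F (cis t) = 0" if t: "norm (circ_poly w m (cis t)) = M" for t
  proof -
    let ?p = "circ_poly w m (cis t)"
    have "?p = circ_poly w m 0 * cis t ^ m * cnj ?p"
      using w by (intro circ_poly_reflect) auto
    then have "?p\<^sup>2 = circ_poly w m 0 * cis t ^ m * (?p * cnj ?p)"
      by (metis mult.commute mult.left_commute power2_eq_square)
    also have "?p * cnj ?p = (of_real M)\<^sup>2" using t by (simp add: complex_norm_square[symmetric])
    finally show ?thesis by (simp add: F_def P poly_monom mult_ac)
  qed
  have "inj_on cis {t\<in>{c<..<c + 2 * pi}. norm (circ_poly w m (cis t)) = M}"
  proof (rule inj_onI)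
    fix s t assume st: "s \<in> {t\<in>{c<..<c + 2 * pi}. norm (circ_poly w m (cis t)) = M}"
      "t \<in> {t\<in>{c<..<c + 2 * pi}. norm (circ_poly w m (cis t)) = M}" "cis s = cis t"
    then show "s = t" using cis_eqD[of s t] cis_eqD[of t s] by (cases "s \<le> t") auto
  qed
  moreover have "finite (cis ` {t\<in>{c<..<c + 2 * pi}. norm (circ_poly w m (cis t)) = M})"
    by (rule finite_subset[OF _ fin]) (use root in auto)
  ultimately show ?thesis by (rule finite_imageD[rotated])
qed

lemma arcs_cover:
  assumes Q: "Q \<subseteq> Gamma" "compact Q" "arc_len Q = 4 * \<beta>" and \<beta>: "0 < \<beta>" "\<beta> < pi / 2"
    and w: "\<And>i. i < m \<Longrightarrow> norm (w i) = 1" and m: "m \<ge> 1" and M: "M > 0"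
    and bound: "\<And>z. z \<in> Q \<Longrightarrow> norm (circ_poly w m z) \<le> M"
  shows "\<exists>n a b. arcs_poly n a b \<beta> m w M"
proof -
  define g where "g t = norm (circ_poly w m (cis t)) - M" for t
  show ?thesis
  proof (cases "\<forall>t. g t \<le> 0")
    case True
    \<comment> \<open>If the polynomial is bounded by \<open>M\<close> on the whole circle, any
      single arc of the right length serves.\<close>
    have arcs: "arcs 1 (\<lambda>_. 0) (\<lambda>_. 4 * \<beta>) \<beta>" using \<beta> by unfold_locales auto
    have "norm (circ_poly w m z) \<le> M" if "z \<in> arcs.E 1 (\<lambda>_. 0) (\<lambda>_. 4 * \<beta>)" for z
    proof -
      obtain t where "z = cis t" using \<open>z \<in> arcs.E _ _ _\<close> unfolding arcs.E_def[OF arcs] by blast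
      then show ?thesis using True by (simp add: g_def)
    qed
    then have "arcs_poly 1 (\<lambda>_. 0) (\<lambda>_. 4 * \<beta>) \<beta> m w M"
      unfolding arcs_poly_def arcs_poly_axioms_def using arcs m w M by blast
    then show ?thesis by blast
  next
    case False
    then obtain c where c: "g c > 0" by (auto simp: not_le)
    have g: "continuous_on UNIV g"
      unfolding g_def circ_poly_def by (intro continuous_intros)
    let ?v = "c + 2 * pi"
    have "\<exists>n a b. interval_decomp g c ?v n a b"
    proof (rule interval_decomp_exists[OF g finite_level_set[where w = w and m = m and M = M and c = c]])
    qed (use w m M in \<open>auto simp: g_def\<close>)
    then obtain n a b where "interval_decomp g c ?v n a b" by blast
    then have d1: "\<And>k. k < n \<Longrightarrow> a k < b k \<and> c \<le> a k \<and> b k \<le> ?v \<and> (\<forall>t\<in>{a k..b k}. g t \<le> 0)"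
      and d2: "\<And>j k. j < k \<Longrightarrow> k < n \<Longrightarrow> b j < a k"
      and d3: "measure lborel {t\<in>{c..?v}. g t \<le> 0} \<le> (\<Sum>k<n. b k - a k)"
      by (auto simp: interval_decomp_def)
    define T where "T = (\<Sum>k<n. b k - a k)"
    have "4 * \<beta> = measure lborel {t\<in>{c..<?v}. cis t \<in> Q}"
      using arc_len_shift[of Q c] Q by (simp add: compact_imp_closed)
    also have "\<dots> \<le> measure lborel {t\<in>{c..?v}. g t \<le> 0}"
    proof (rule measure_mono_fmeasurable)
      have "{t. cis t \<in> Q} \<inter> {c..<?v} \<in> sets borel"
        using cis_vimage_closed[of Q] Q by (intro sets.Int) (auto simp: compact_imp_closed)
      moreover have "{t. cis t \<in> Q} \<inter> {c..<?v} = {t\<in>{c..<?v}. cis t \<in> Q}" by auto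
      ultimately show "{t\<in>{c..<?v}. cis t \<in> Q} \<in> sets lborel" by simp
      show "{t\<in>{c..?v}. g t \<le> 0} \<in> fmeasurable lborel"
        by (rule fmeasurable_compact[OF compact_sublevel[OF g]])
      show "{t\<in>{c..<?v}. cis t \<in> Q} \<subseteq> {t\<in>{c..?v}. g t \<le> 0}"
        using bound by (auto simp: g_def)
    qed
    finally have T: "4 * \<beta> \<le> T" using d3 by (simp add: T_def)
    \<comment> \<open>The arcs of the sublevel set may be too long in total; shrinking all of them
      by one factor makes the total exactly \<open>4 * \<beta>\<close>.\<close>
    define \<rho> where "\<rho> = 4 * \<beta> / T"
    have \<rho>: "0 < \<rho>" "\<rho> \<le> 1" using T \<beta> by (auto simp: \<rho>_def)
    define b' where "b' k = a k + \<rho> * (b k - a k)" for k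
    have b': "a k < b' k" "b' k \<le> b k" if "k < n" for k
    proof -
      have d: "b k - a k > 0" using d1[OF that] by simp
      then show "a k < b' k" using \<rho> by (simp add: b'_def)
      have "\<rho> * (b k - a k) \<le> 1 * (b k - a k)" using d \<rho> by (intro mult_right_mono) auto
      then show "b' k \<le> b k" by (simp add: b'_def)
    qed
    \<comment> \<open>The cut \<open>c\<close> was chosen with \<open>g c > 0\<close>, so no arc
      starts there; this gives the strict inequality in \<open>wrap\<close>.\<close>
    have ac: "c < a k" if "k < n" for k
      using d1[OF that] c by (metis atLeastAtMost_iff less_eq_real_def not_less order_refl)
    have arcs: "arcs n a b' \<beta>"
    proof
      show "b' j < a k" if "j < k" "k < n" for j k using b'(2)[of j] d2[OF that] that by force
      show "b' j < a k + 2 * pi" if "j < n" "k < n" for j k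
        using b'(2)[of j] d1[of j] ac[of k] that by force
      have "(\<Sum>k<n. b' k - a k) = \<rho> * T" by (simp add: b'_def T_def sum_distrib_left)
      then show "(\<Sum>k<n. b' k - a k) = 4 * \<beta>" using T \<beta> by (simp add: \<rho>_def)
    qed (use b' \<beta> in auto)
    have "norm (circ_poly w m (cis t)) \<le> M" if "k < n" "t \<in> {a k..b' k}" for k t
      using d1[of k] b'(2)[of k] that by (force simp: g_def)
    then have "arcs_poly n a b' \<beta> m w M"
      using arcs m w M by (auto simp: arcs_poly_def arcs_poly_axioms_def arcs.E_def[OF arcs])
    then show ?thesis by blast
  qed
qed

text \<open>A missing point of the arc yields a missing open interval, as \<open>Q\<close> is
  closed, and hence a loss of length.\<close>

lemma compact_full_measure_arc:
  assumes Q: "compact Q" "Q \<subseteq> cis ` {a..b}" and ab: "a < b" "b < a + 2 * pi" and len: "arc_len Q = b - a"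
  shows "Q = cis ` {a..b}"
proof (rule ccontr)
  assume "Q \<noteq> cis ` {a..b}"
  then obtain t where t: "t \<in> {a..b}" "cis t \<notin> Q" using Q(2) by blast
  let ?V = "- {t. cis t \<in> Q}"
  have V: "open ?V" using cis_vimage_closed[of Q] Q by (simp add: compact_imp_closed open_Compl)
  \<comment> \<open>The missing point may be an endpoint, so it is replaced by a nearby interior
    one.\<close>
  have "t \<in> closure {a<..<b}" using t ab by simp
  then have "?V \<inter> {a<..<b} \<noteq> {}" using open_Int_closure_eq_empty[OF V, of "{a<..<b}"] t by auto
  then obtain s where s: "s \<in> ?V \<inter> {a<..<b}" by blast
  moreover have "open (?V \<inter> {a<..<b})" using V by auto
  ultimately obtain e where e: "e > 0" "ball s e \<subseteq> ?V \<inter> {a<..<b}" by (meson openE)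
  have "b - a = measure lborel {t\<in>{a..<a + 2 * pi}. cis t \<in> Q}"
    using arc_len_shift[of Q a] Q len by (simp add: compact_imp_closed)
  also have "\<dots> \<le> measure lborel ({a..b} - {s - e<..<s + e})"
  proof (rule measure_mono_fmeasurable)
    show "{t\<in>{a..<a + 2 * pi}. cis t \<in> Q} \<subseteq> {a..b} - {s - e<..<s + e}"
    proof
      fix x assume x: "x \<in> {t\<in>{a..<a + 2 * pi}. cis t \<in> Q}"
      then obtain y where y: "y \<in> {a..b}" "cis x = cis y" using Q by auto
      have "x = y" using cis_eqD[of x y] cis_eqD[of y x] x y ab by (cases "x \<le> y") auto
      moreover have "x \<notin> ball s e" using e x by auto
      ultimately show "x \<in> {a..b} - {s - e<..<s + e}" using y by (auto simp: ball_eq_greaterThanLessThan)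
    qed
    have "{t. cis t \<in> Q} \<inter> {a..<a + 2 * pi} \<in> sets borel"
      using cis_vimage_closed[of Q] Q by (intro sets.Int) (auto simp: compact_imp_closed)
    moreover have "{t. cis t \<in> Q} \<inter> {a..<a + 2 * pi} = {t\<in>{a..<a + 2 * pi}. cis t \<in> Q}" by auto
    ultimately show "{t\<in>{a..<a + 2 * pi}. cis t \<in> Q} \<in> sets lborel" by simp
    show "{a..b} - {s - e<..<s + e} \<in> fmeasurable lborel"
      by (intro fmeasurable_compact compact_diff) auto
  qed
  also have "\<dots> = (b - a) - 2 * e"
  proof -
    have "{s - e<..<s + e} \<subseteq> {a..b}"
      using e by (auto simp: ball_eq_greaterThanLessThan[symmetric] subset_iff)
    then have "measure lborel ({a..b} - {s - e<..<s + e}) = measure lborel {a..b} - measure lborel {s - e<..<s + e}"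
      by (intro measurable_measure_Diff) (auto intro: fmeasurable_compact)
    then show ?thesis using ab e by simp
  qed
  finally show False using e by simp
qed

lemma compact_circle_bound:
  assumes Q: "Q \<subseteq> Gamma" "compact Q" "arc_len Q = 4 * \<beta>" and \<beta>: "0 < \<beta>" "\<beta> < pi / 2"
    and w: "\<And>i. i < m \<Longrightarrow> norm (w i) = 1" and m: "m \<ge> 1" and M: "M > 0"
    and bound: "\<And>z. z \<in> Q \<Longrightarrow> norm (circ_poly w m z) \<le> M"
  shows "2 * sin \<beta> ^ m \<le> M" "M = 2 * sin \<beta> ^ m \<Longrightarrow> is_arc Q (4 * \<beta>)"
proof -
  obtain n a b where cover: "arcs_poly n a b \<beta> m w M" using arcs_cover[OF assms] by auto
  have Q_bound: "norm (circ_poly w m z) \<le> M" if "z \<in> Q" for z using bound that .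
  interpret arcs_poly n a b \<beta> m w M by (rule cover)
  show "2 * sin \<beta> ^ m \<le> M" by (rule lower_bound)
  assume Meq: "M = 2 * sin \<beta> ^ m"
  have n: "n = 1" by (rule extremal_single_arc[OF Meq])
  have b: "b 0 = a 0 + 4 * \<beta>" using total n by simp
  \<comment> \<open>The arcs came from the sublevel set and carry no inclusion of \<open>Q\<close>;
    only under equality does \<open>extremal_not_on_circle\<close> supply it.\<close>
  have "Q \<subseteq> E"
  proof
    fix z assume z: "z \<in> Q"
    then have "norm z = 1" using Q(1) by (auto simp: Gamma_def)
    then show "z \<in> E" using extremal_not_on_circle[OF Meq, of z] Q_bound[OF z] by force
  qed
  moreover have "E \<subseteq> cis ` {a 0..b 0}" unfolding E_def using n by auto
  ultimately have "Q \<subseteq> cis ` {a 0..b 0}" by blast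
  then have "Q = cis ` {a 0..b 0}"
    using Q \<beta> b by (intro compact_full_measure_arc) auto
  then show "is_arc Q (4 * \<beta>)" unfolding is_arc_def b by blast
qed

section \<open>The extremal polynomial\<close>

lemma prod_roots_minus_one:
  assumes m: "m \<ge> 1"
  shows "(\<Prod>j<m. z - cis ((2 * real j + 1) * pi / real m)) = z ^ m + 1"
proof -
  let ?f = "\<lambda>j. cis ((2 * real j + 1) * pi / real m)"
  let ?P = "\<Prod>j<m. [:- ?f j, 1:]" and ?Q = "monom 1 m + 1 :: complex poly"
  have inj: "inj_on ?f {..<m}"
  proof -
    have "?f i \<noteq> ?f j" if ij: "i < j" "j < m" for i j
    proof
      assume eq: "?f i = ?f j"
      have "(2 * real j + 1) * pi / real m < (2 * real i + 1) * pi / real m + 2 * pi"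
      proof -
        have "(2 * real j + 1) * pi < (2 * real i + 1 + 2 * real m) * pi"
          using ij by (intro mult_strict_right_mono) auto
        then have "(2 * real j + 1) * pi / real m < (2 * real i + 1 + 2 * real m) * pi / real m"
          using m by (intro divide_strict_right_mono) auto
        also have "\<dots> = (2 * real i + 1) * pi / real m + 2 * pi"
          using m by (simp add: field_simps)
        finally show ?thesis .
      qed
      moreover have "(2 * real i + 1) * pi / real m \<le> (2 * real j + 1) * pi / real m"
        using ij by (intro divide_right_mono mult_right_mono) auto
      ultimately have "(2 * real i + 1) * pi / real m = (2 * real j + 1) * pi / real m"
        using cis_eqD[OF eq] by blast
      then show False using ij by simp
    qed
    then show ?thesis by (intro inj_onI) (metis lessThan_iff linorder_neqE_nat)
  qed
  have root: "?f j ^ m = -1" for j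
  proof -
    have "real m * ((2 * real j + 1) * pi / real m) = real j * (2 * pi) + pi"
    proof -
      have "real m * ((2 * real j + 1) * pi / real m) = (2 * real j + 1) * pi" using m by simp
      then show ?thesis by (simp only: algebra_simps)
    qed
    then have "?f j ^ m = cis (real j * (2 * pi) + pi)"
      by (simp only: Complex.DeMoivre)
    also have "\<dots> = cis (real j * (2 * pi)) * cis pi" by (simp only: cis_mult)
    also have "cis (real j * (2 * pi)) = 1"
      using cis_multiple_2pi[of "real j"] by (simp add: mult_ac)
    finally have "?f j ^ m = 1 * cis pi" .
    then show ?thesis by (simp only: cis_pi mult_1)
  qed
  have cQ: "coeff ?Q m = 1" using m by simp
  have "?P = ?Q"
  proof (rule poly_eqI_degree_lead_coeff[where n = m and A = "?f ` {..<m}"])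
    show "card (?f ` {..<m}) \<ge> m" using inj by (simp add: card_image)
    show "degree ?P \<le> m" "coeff ?P m = coeff ?Q m"
      using linear_prod_poly[where n = m and f = ?f] cQ by auto
    show "degree ?Q \<le> m" by (intro degree_add_le) (auto simp: degree_monom_le)
    fix x assume "x \<in> ?f ` {..<m}"
    then obtain j where j: "j < m" "x = ?f j" by auto
    have "poly ?P x = 0" using j by (auto simp: linear_prod_poly(3))
    moreover have "poly ?Q x = 0" using j root by (simp add: poly_monom)
    ultimately show "poly ?P x = poly ?Q x" by simp
  qed
  then have "poly ?P z = poly ?Q z" by simp
  then show ?thesis by (simp add: linear_prod_poly(3) poly_monom)
qed

lemma norm_cis_diff: "norm (cis t - cis s) = 2 * \<bar>sin ((t - s) / 2)\<bar>"
  by (simp add: cis_diff norm_mult)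

text \<open>The factors are the distances from \<open>cis (2 * x)\<close> to the roots of
  \<open>z ^ m = -1\<close>.\<close>

lemma prod_sin_le_2:
  assumes m: "m \<ge> 1"
  shows "(\<Prod>j<m. 2 * \<bar>sin (x - (2 * real j + 1) * pi / (2 * real m))\<bar>) \<le> 2"
proof -
  have "(\<Prod>j<m. 2 * \<bar>sin (x - (2 * real j + 1) * pi / (2 * real m))\<bar>) =
      norm (\<Prod>j<m. cis (2 * x) - cis ((2 * real j + 1) * pi / real m))"
    by (simp add: prod_norm[symmetric] norm_cis_diff diff_divide_distrib mult.commute)
  also have "\<dots> \<le> norm (cis (2 * x) ^ m) + norm (1 :: complex)"
    unfolding prod_roots_minus_one[OF m] by (rule norm_triangle_ineq)
  also have "\<dots> = 2" by (simp add: norm_power)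
  finally show ?thesis .
qed

text \<open>The zeros are those of the Chebyshev polynomial of degree \<open>m\<close> in \<open>sin ((t - s) / 2) / sin \<beta>\<close>.\<close>

lemma extremal_circ_poly:
  assumes \<beta>: "0 < \<beta>" "\<beta> < pi / 2" and m: "m \<ge> 1"
  obtains w where "\<And>i. norm (w i) = 1"
    "\<And>t. t \<in> {s - 2 * \<beta>..s + 2 * \<beta>} \<Longrightarrow> norm (circ_poly w m (cis t)) \<le> 2 * sin \<beta> ^ m"
proof
  define \<psi> where "\<psi> j = (2 * real j + 1) * pi / (2 * real m)" for j
  define \<tau> where "\<tau> j = arcsin (sin \<beta> * cos (\<psi> j))" for j
  let ?w = "\<lambda>j. cis (s + 2 * \<tau> j)"
  have sb: "0 < sin \<beta>" "sin \<beta> \<le> 1" using \<beta> by (auto intro: sin_gt_zero)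
  have abs_le: "\<bar>sin \<beta> * cos (\<psi> j)\<bar> \<le> 1" for j
    using sb mult_mono[of "sin \<beta>" 1 "\<bar>cos (\<psi> j)\<bar>" 1] by (simp add: abs_mult)
  have sin_\<tau>: "sin (\<tau> j) = sin \<beta> * cos (\<psi> j)" for j
    unfolding \<tau>_def using abs_le[of j] by (intro sin_arcsin) auto
  \<comment> \<open>Reversing the index sends \<open>\<psi> j\<close> to
    \<open>pi - \<psi> j\<close>, so the zeros lie symmetrically about \<open>s\<close>.\<close>
  have \<tau>_refl: "\<tau> (m - Suc j) = - \<tau> j" if "j < m" for j
  proof -
    have "real (m - Suc j) = real m - 1 - real j" using that by (simp add: of_nat_diff)
    then have "\<psi> (m - Suc j) = pi - \<psi> j" using m by (simp add: \<psi>_def field_simps)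
    then show ?thesis using abs_le[of j] by (simp add: \<tau>_def arcsin_minus)
  qed
  show "norm (?w i) = 1" for i by simp
  fix t assume t: "t \<in> {s - 2 * \<beta>..s + 2 * \<beta>}"
  define x where "x = (t - s) / 2"
  have x: "- \<beta> \<le> x" "x \<le> \<beta>" using t by (auto simp: x_def field_simps)
  have "sin x \<le> sin \<beta>" "sin (- \<beta>) \<le> sin x" using x \<beta> by (intro sin_monotone_2pi_le; simp)+
  then have "\<bar>sin x / sin \<beta>\<bar> \<le> 1" using sb by (simp add: field_simps abs_le_iff)
  \<comment> \<open>The Chebyshev substitution, under which \<open>sin x = sin (\<tau> j)\<close>
    becomes \<open>cos y = cos (\<psi> j)\<close>.\<close>
  then obtain y where y: "sin x = sin \<beta> * cos y"
    using sb cos_arccos_abs[of "sin x / sin \<beta>"] by (metis nonzero_mult_div_cancel_left times_divide_eq_right less_irrefl)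
  have norm_p: "norm (circ_poly ?w m (cis t)) = (\<Prod>j<m. 2 * \<bar>sin (x - \<tau> j)\<bar>)"
    by (simp add: circ_poly_def prod_norm[symmetric] norm_cis_diff x_def diff_divide_distrib add_divide_distrib algebra_simps)
  have "(\<Prod>j<m. 2 * \<bar>sin (x - \<tau> j)\<bar>) = (\<Prod>j<m. 2 * \<bar>sin (x - \<tau> (m - Suc j))\<bar>)"
    by (rule prod.nat_diff_reindex[symmetric])
  also have "\<dots> = (\<Prod>j<m. 2 * \<bar>sin (x + \<tau> j)\<bar>)"
    by (intro prod.cong) (auto simp: \<tau>_refl)
  \<comment> \<open>Squaring pairs every zero with its mirror image, including the central one for
    odd \<open>m\<close>.\<close>
  finally have "norm (circ_poly ?w m (cis t)) ^ 2 = (\<Prod>j<m. (2 * \<bar>sin (x - \<tau> j)\<bar>) * (2 * \<bar>sin (x + \<tau> j)\<bar>))"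
    unfolding norm_p power2_eq_square prod.distrib by simp
  also have "\<dots> = (\<Prod>j<m. (sin \<beta>)\<^sup>2 * ((2 * \<bar>sin (y - \<psi> j)\<bar>) * (2 * \<bar>sin (- y - \<psi> j)\<bar>)))"
  proof (rule prod.cong[OF refl])
    fix j
    have prod_sin: "sin (u - v) * sin (u + v) = (sin u)\<^sup>2 - (sin v)\<^sup>2" for u v :: real
    proof -
      have "sin (u - v) * sin (u + v) = (sin u)\<^sup>2 * (cos v)\<^sup>2 - (cos u)\<^sup>2 * (sin v)\<^sup>2"
        by (simp add: sin_add sin_diff algebra_simps power2_eq_square)
      then show ?thesis by (simp add: cos_squared_eq algebra_simps)
    qed
    have "sin (x - \<tau> j) * sin (x + \<tau> j) = (sin \<beta>)\<^sup>2 * ((cos y)\<^sup>2 - (cos (\<psi> j))\<^sup>2)"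
      unfolding prod_sin sin_\<tau> y by (simp add: power_mult_distrib algebra_simps)
    also have "(cos y)\<^sup>2 - (cos (\<psi> j))\<^sup>2 = - (sin (y - \<psi> j) * sin (y + \<psi> j))"
      unfolding prod_sin by (simp add: cos_squared_eq)
    finally have "\<bar>sin (x - \<tau> j) * sin (x + \<tau> j)\<bar> = (sin \<beta>)\<^sup>2 * \<bar>sin (y - \<psi> j) * sin (y + \<psi> j)\<bar>"
      by (simp add: abs_mult)
    moreover have "\<bar>sin (- y - \<psi> j)\<bar> = \<bar>sin (y + \<psi> j)\<bar>"
    proof -
      have "- y - \<psi> j = - (y + \<psi> j)" by simp
      then show ?thesis by (simp only: sin_minus abs_minus_cancel)
    qed
    ultimately show "2 * \<bar>sin (x - \<tau> j)\<bar> * (2 * \<bar>sin (x + \<tau> j)\<bar>) =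
        (sin \<beta>)\<^sup>2 * (2 * \<bar>sin (y - \<psi> j)\<bar> * (2 * \<bar>sin (- y - \<psi> j)\<bar>))"
      by (simp add: abs_mult)
  qed
  also have "\<dots> = (sin \<beta> ^ m)\<^sup>2 * ((\<Prod>j<m. 2 * \<bar>sin (y - \<psi> j)\<bar>) * (\<Prod>j<m. 2 * \<bar>sin (- y - \<psi> j)\<bar>))"
    unfolding prod.distrib by (simp add: power_mult[symmetric] mult.commute)
  also have "\<dots> \<le> (sin \<beta> ^ m)\<^sup>2 * (2 * 2)"
    unfolding \<psi>_def by (intro mult_left_mono mult_mono prod_sin_le_2 m prod_nonneg) auto
  also have "\<dots> = (2 * sin \<beta> ^ m)\<^sup>2" by (simp add: power_mult_distrib)
  finally show "norm (circ_poly ?w m (cis t)) \<le> 2 * sin \<beta> ^ m"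
    by (rule power2_le_imp_le) (use sb in simp)
qed

section \<open>Existence of a minimising polynomial\<close>

lemma monic_circ_polys_iff:
  "P \<in> monic_circ_polys m \<longleftrightarrow> (\<exists>w. (\<forall>i<m. norm (w i) = 1) \<and> P = (\<Prod>i<m. [:- w i, 1:]))"
proof
  assume P: "P \<in> monic_circ_polys m"
  then have "P \<noteq> 0" by (auto simp: monic_circ_polys_def)
  then obtain X where X: "size X = degree P" "P = smult (lead_coeff P) (\<Prod>x\<in>#X. [:- x, 1:])"
    using alg_closed_imp_factorization by blast
  obtain xs where xs: "mset xs = X" using ex_mset by blast
  have len: "length xs = m" using X(1) xs P by (auto simp: monic_circ_polys_def)
  have "lead_coeff P = 1" using P by (auto simp: monic_circ_polys_def)
  then have "P = (\<Prod>x\<in>#X. [:- x, 1:])" using X(2) by (metis smult_1_left)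
  also have "\<dots> = prod_list (map (\<lambda>x. [:- x, 1:]) xs)"
    unfolding xs[symmetric] by (metis mset_map prod_mset_prod_list)
  also have "\<dots> = (\<Prod>i<m. [:- (xs ! i), 1:])"
    by (simp add: prod.list_conv_set_nth len atLeast0LessThan)
  finally have eq: "P = (\<Prod>i<m. [:- (xs ! i), 1:])" .
  have "norm (xs ! i) = 1" if "i < m" for i
  proof -
    have "poly P (xs ! i) = 0" unfolding eq poly_prod using that by (auto intro!: bexI[of _ i])
    then show ?thesis using P by (auto simp: monic_circ_polys_def Gamma_def)
  qed
  then show "\<exists>w. (\<forall>i<m. norm (w i) = 1) \<and> P = (\<Prod>i<m. [:- w i, 1:])" using eq by blast
next
  assume "\<exists>w. (\<forall>i<m. norm (w i) = 1) \<and> P = (\<Prod>i<m. [:- w i, 1:])"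
  then obtain w where w: "\<And>i. i < m \<Longrightarrow> norm (w i) = 1" "P = (\<Prod>i<m. [:- w i, 1:])" by blast
  then show "P \<in> monic_circ_polys m"
    using linear_prod_poly[where n = m and f = w] by (auto simp: monic_circ_polys_def Gamma_def)
qed

lemma poly_circ_poly: "poly (\<Prod>i<m. [:- w i, 1:]) = circ_poly w m"
  by (rule ext) (simp add: circ_poly_def linear_prod_poly(3))

lemma finite_coordinates_subseq:
  fixes W :: "nat \<Rightarrow> 'i \<Rightarrow> 'a :: metric_space"
  assumes I: "finite I" and C: "compact C" "\<And>k i. i \<in> I \<Longrightarrow> W k i \<in> C"
  shows "\<exists>r l. strict_mono (r :: nat \<Rightarrow> nat) \<and> (\<forall>i\<in>I. l i \<in> C \<and> (\<lambda>k. W (r k) i) \<longlonglongrightarrow> l i)"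
  using I C(2)
proof (induction I)
  case empty
  show ?case by (intro exI[of _ id]) (auto simp: strict_mono_def)
next
  case (insert j I)
  then obtain r l where rl: "strict_mono (r :: nat \<Rightarrow> nat)" "\<forall>i\<in>I. l i \<in> C \<and> (\<lambda>k. W (r k) i) \<longlonglongrightarrow> l i"
    by auto
  have "\<exists>x\<in>C. \<exists>q. strict_mono (q :: nat \<Rightarrow> nat) \<and> ((\<lambda>k. W (r k) j) \<circ> q) \<longlonglongrightarrow> x"
    using insert.prems by (intro C(1)[unfolded compact_def, rule_format]) auto
  then obtain x q where q: "x \<in> C" "strict_mono (q :: nat \<Rightarrow> nat)" "((\<lambda>k. W (r k) j) \<circ> q) \<longlonglongrightarrow> x"
    by blast
  have "(\<lambda>k. W ((r \<circ> q) k) i) \<longlonglongrightarrow> (l(j := x)) i \<and> (l(j := x)) i \<in> C" if "i \<in> insert j I" for i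
  proof (cases "i = j")
    case True
    then show ?thesis using q by (simp add: o_def)
  next
    case False
    then have "i \<in> I" using that by auto
    then show ?thesis using rl(2) LIMSEQ_subseq_LIMSEQ[OF _ q(2), of "\<lambda>k. W (r k) i"] False
      by (auto simp: o_def)
  qed
  then show ?case using strict_mono_o[OF rl(1) q(2)] by blast
qed

text \<open>In a minimising sequence the zeros lie on the compact circle, and a subsequence along
  which all of them converge yields a minimiser. The equality discussion thus concerns an actual
  polynomial.\<close>

lemma E_set_attained:
  assumes Q: "compact Q" "Q \<noteq> {}"
  obtains w where "\<And>i. i < m \<Longrightarrow> norm (w i) = 1" "\<And>z. z \<in> Q \<Longrightarrow> norm (circ_poly w m z) \<le> E_set m Q"
proof -
  let ?S = "\<lambda>P. SUP z\<in>Q. cmod (poly P z)"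
  have ne: "?S ` monic_circ_polys m \<noteq> {}"
  proof -
    have "(\<Prod>i<m. [:- 1, 1:]) \<in> monic_circ_polys m"
      unfolding monic_circ_polys_iff by (rule exI[of _ "\<lambda>_. 1"]) simp
    then show ?thesis by blast
  qed
  have bdd: "bdd_above ((\<lambda>z. cmod (poly P z)) ` Q)" for P
    using Q by (intro bounded_imp_bdd_above compact_imp_bounded compact_continuous_image continuous_intros)
  have "\<exists>w. (\<forall>i<m. norm (w i) = 1) \<and> (\<forall>z\<in>Q. norm (circ_poly w m z) \<le> E_set m Q + 1 / real (Suc k))" for k
  proof -
    have "Inf (?S ` monic_circ_polys m) < E_set m Q + 1 / real (Suc k)" by (simp add: E_set_def)
    then obtain P where P: "P \<in> monic_circ_polys m" "?S P < E_set m Q + 1 / real (Suc k)"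
      using cInf_lessD[OF ne] by blast
    then obtain w where w: "\<forall>i<m. norm (w i) = 1" "P = (\<Prod>i<m. [:- w i, 1:])"
      using monic_circ_polys_iff by blast
    have "norm (circ_poly w m z) \<le> E_set m Q + 1 / real (Suc k)" if "z \<in> Q" for z
      using cSUP_upper[OF that bdd[of P]] P(2) w by (simp add: poly_circ_poly)
    then show ?thesis using w by blast
  qed
  then obtain W where W: "\<And>k i. i < m \<Longrightarrow> norm (W k i) = 1"
    "\<And>k z. z \<in> Q \<Longrightarrow> norm (circ_poly (W k) m z) \<le> E_set m Q + 1 / real (Suc k)"
    by metis
  obtain r l where rl: "strict_mono (r :: nat \<Rightarrow> nat)"
    "\<forall>i\<in>{..<m}. l i \<in> sphere (0::complex) 1 \<and> (\<lambda>k. W (r k) i) \<longlonglongrightarrow> l i"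
    using finite_coordinates_subseq[of "{..<m}" "sphere (0::complex) 1" W] W(1) by auto
  show ?thesis
  proof
    show "norm (l i) = 1" if "i < m" for i using rl(2) that by auto
    fix z assume z: "z \<in> Q"
    have "(\<lambda>k. norm (circ_poly (W (r k)) m z)) \<longlonglongrightarrow> norm (circ_poly l m z)"
      unfolding circ_poly_def using rl(2) by (intro tendsto_intros) auto
    moreover have "(\<lambda>k. E_set m Q + 1 / real (Suc (r k))) \<longlonglongrightarrow> E_set m Q + 0"
      using LIMSEQ_subseq_LIMSEQ[OF LIMSEQ_inverse_real_of_nat rl(1)]
      by (intro tendsto_intros) (simp add: o_def inverse_eq_divide)
    ultimately have "norm (circ_poly l m z) \<le> E_set m Q + 0"
      by (rule LIMSEQ_le) (use W(2)[OF z] in blast)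
    then show "norm (circ_poly l m z) \<le> E_set m Q" by simp
  qed
qed

section \<open>Both bounds for \<open>E_set\<close> and the conclusion\<close>

lemma arc_len_empty: "arc_len {} = 0"
  by (simp add: arc_len_def)

lemma E_set_ge:
  assumes Q: "Q \<subseteq> Gamma" "compact Q" "arc_len Q = 4 * \<beta>" and \<beta>: "0 < \<beta>" "\<beta> < pi / 2" and m: "m \<ge> 1"
  shows "2 * sin \<beta> ^ m \<le> E_set m Q"
    and "E_set m Q = 2 * sin \<beta> ^ m \<Longrightarrow> is_arc Q (4 * \<beta>)"
proof -
  have ne: "Q \<noteq> {}" using Q \<beta> arc_len_empty by auto
  have s: "sin \<beta> > 0" using \<beta> by (intro sin_gt_zero) auto
  obtain w where w: "\<And>i. i < m \<Longrightarrow> norm (w i) = 1" "\<And>z. z \<in> Q \<Longrightarrow> norm (circ_poly w m z) \<le> E_set m Q"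
    using E_set_attained[OF Q(2) ne] by blast
  show "2 * sin \<beta> ^ m \<le> E_set m Q"
  proof -
    \<comment> \<open>The maximum guarantees a positive bound \<open>M\<close>; its second entry is
      too small to reach \<open>2 * sin \<beta> ^ m\<close>.\<close>
    have "2 * sin \<beta> ^ m \<le> max (E_set m Q) (sin \<beta> ^ m)"
      using s w(2) by (intro compact_circle_bound(1)[OF Q \<beta> w(1) m]) (auto simp: le_max_iff_disj less_max_iff_disj)
    moreover have "sin \<beta> ^ m < 2 * sin \<beta> ^ m" using s by simp
    ultimately show ?thesis by (simp add: le_max_iff_disj)
  qed
  assume eq: "E_set m Q = 2 * sin \<beta> ^ m"
  show "is_arc Q (4 * \<beta>)"
    using s w(2) eq by (intro compact_circle_bound(2)[OF Q \<beta> w(1) m, where M = "E_set m Q"]) auto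
qed

lemma E_set_arc_le:
  assumes Q: "is_arc Q (4 * \<beta>)" and \<beta>: "0 < \<beta>" "\<beta> < pi / 2" and m: "m \<ge> 1"
  shows "E_set m Q \<le> 2 * sin \<beta> ^ m"
proof -
  obtain a where a: "Q = cis ` {a..a + 4 * \<beta>}" using Q by (auto simp: is_arc_def)
  have ne: "Q \<noteq> {}" using a \<beta> by auto
  have cQ: "compact Q" unfolding a by (intro compact_continuous_image continuous_intros) auto
  \<comment> \<open>The extremal polynomial is built symmetrically about the midpoint
    \<open>a + 2 * \<beta>\<close> of the arc.\<close>
  obtain w where w: "\<And>i. norm (w i) = 1"
    "\<And>t. t \<in> {(a + 2 * \<beta>) - 2 * \<beta>..(a + 2 * \<beta>) + 2 * \<beta>} \<Longrightarrow> norm (circ_poly w m (cis t)) \<le> 2 * sin \<beta> ^ m"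
    using extremal_circ_poly[OF \<beta> m] by blast
  let ?P = "\<Prod>i<m. [:- w i, 1:]"
  have bd: "bdd_above ((\<lambda>z. cmod (poly P z)) ` Q)" for P
    using cQ by (intro bounded_imp_bdd_above compact_imp_bounded compact_continuous_image continuous_intros)
  have "0 \<le> (SUP z\<in>Q. cmod (poly P z))" for P
    using ne bd[of P] by (meson all_not_in_conv cSUP_upper2 norm_ge_zero)
  then have bb: "bdd_below ((\<lambda>P. SUP z\<in>Q. cmod (poly P z)) ` monic_circ_polys m)"
    by (intro bdd_belowI[of _ 0]) auto
  have mem: "?P \<in> monic_circ_polys m" unfolding monic_circ_polys_iff by (rule exI[of _ w]) (simp add: w(1))
  have "(SUP z\<in>Q. cmod (poly ?P z)) \<le> 2 * sin \<beta> ^ m"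
  proof (rule cSUP_least[OF ne])
    fix z assume "z \<in> Q"
    then obtain t where "t \<in> {a..a + 4 * \<beta>}" "z = cis t" using a by auto
    then show "cmod (poly ?P z) \<le> 2 * sin \<beta> ^ m" using w(2)[of t] by (simp add: poly_circ_poly)
  qed
  then show ?thesis unfolding E_set_def by (rule cINF_lower2[OF bb mem])
qed

lemma initial_arc:
  assumes "0 < \<beta>" "\<beta> < pi / 2"
  defines "Q \<equiv> cis ` {0..4 * \<beta>}"
  shows "Q \<subseteq> Gamma" "compact Q" "arc_len Q = 4 * \<beta>" "is_arc Q (4 * \<beta>)"
proof -
  show "Q \<subseteq> Gamma" by (auto simp: Q_def Gamma_def)
  show "compact Q" unfolding Q_def by (intro compact_continuous_image continuous_intros) auto
  show "is_arc Q (4 * \<beta>)" unfolding is_arc_def Q_def by (intro exI[of _ 0]) simp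
  have eq: "{t\<in>{0..<2 * pi}. cis t \<in> Q} = {0..4 * \<beta>}"
  proof (intro equalityI subsetI)
    fix t assume t: "t \<in> {t\<in>{0..<2 * pi}. cis t \<in> Q}"
    then have "cis t \<in> Q" by blast
    then obtain s where s: "s \<in> {0..4 * \<beta>}" "cis t = cis s" unfolding Q_def by blast
    have st: "0 \<le> t" "t < 2 * pi" "0 \<le> s" "s < 2 * pi" using s(1) t assms(2) by simp_all
    have "t = s"
      using cis_eqD[OF s(2)] cis_eqD[OF s(2)[symmetric]] st by linarith
    then show "t \<in> {0..4 * \<beta>}" using s by simp
  next
    fix t assume t: "t \<in> {0..4 * \<beta>}"
    then have "cis t \<in> Q" unfolding Q_def by (rule imageI)
    then show "t \<in> {t\<in>{0..<2 * pi}. cis t \<in> Q}" using t assms(2) by simp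
  qed
  show "arc_len Q = 4 * \<beta>" unfolding arc_len_def eq using assms(1) by simp
qed

theorem theorem7:
  fixes m :: nat and \<alpha> :: real
  assumes "m \<ge> 1" and "0 < \<alpha>" and "\<alpha> < pi"
  shows "(\<forall>Q. Q \<subseteq> Gamma \<and> compact Q \<and> arc_len Q = 2*\<alpha> \<longrightarrow>
            E_set m Q \<ge> 2 * sin (\<alpha>/2) ^ m \<and>
            (E_set m Q = 2 * sin (\<alpha>/2) ^ m \<longleftrightarrow> is_arc Q (2*\<alpha>)))
         \<and> E_len m (2*\<alpha>) = 2 * sin (\<alpha>/2) ^ m"
proof -
  define \<beta> where "\<beta> = \<alpha> / 2"
  have \<beta>: "0 < \<beta>" "\<beta> < pi / 2" "2 * \<alpha> = 4 * \<beta>" using assms by (auto simp: \<beta>_def)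
  have main: "2 * sin \<beta> ^ m \<le> E_set m Q \<and> (E_set m Q = 2 * sin \<beta> ^ m \<longleftrightarrow> is_arc Q (4 * \<beta>))"
    if "Q \<subseteq> Gamma" "compact Q" "arc_len Q = 4 * \<beta>" for Q
    using E_set_ge[OF that \<beta>(1,2) assms(1)] E_set_arc_le[OF _ \<beta>(1,2) assms(1), of Q] by force
  have "E_len m (4 * \<beta>) = 2 * sin \<beta> ^ m"
    unfolding E_len_def
  proof (rule cInf_eq_minimum)
    let ?Q = "cis ` {0..4 * \<beta>}"
    have "E_set m ?Q = 2 * sin \<beta> ^ m"
      using main[of ?Q] initial_arc[OF \<beta>(1,2)] by blast
    then show "2 * sin \<beta> ^ m \<in> E_set m ` {Q. Q \<subseteq> Gamma \<and> compact Q \<and> arc_len Q = 4 * \<beta>}"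
      using initial_arc[OF \<beta>(1,2)] by (intro image_eqI[of _ _ ?Q]) auto
  qed (use main in auto)
  then show ?thesis using main unfolding \<beta>(3) \<beta>_def[symmetric] by blast
qed

end
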